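(* There are no closed non-CMC biconservative surfaces in 3-dimensional Riemannian space forms $N^3(\rho)$ with $\rho\le 0$.
   Context: $N^3(\rho)$ denotes the 3-dimensional Riemannian space form of constant sectional curvature $\rho$; for $\rho\le0$ it is $\mathbb{R}^3$ (if $\rho=0$) or the hyperbolic space $\mathbb{H}^3(\rho)$ (if $\rho<0$). Surfaces are connected, smooth and isometrically immersed; closed means compact without boundary. A surface in $N^3(\rho)$ with unit normal $\eta$, shape operator $S_\eta$ and mean curvature function $H=\frac12\operatorname{trace}S_\eta$ is biconservative if $2S_\eta(\operatorname{grad}H)+2H\operatorname{grad}H=0$. It is CMC if $H$ is constant, and non-CMC otherwise. *)

theory Defs
  imports "HOL-Analysis.Analysis"
begin

section \<open>Smooth maps and smooth surfaces\<close>

text \<open>\<^term>\<open>Ck_on k S f\<close> is meant for open \<^term>\<open>S\<close>.\<close>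

fun Ck_on :: "nat \<Rightarrow> 'a::real_normed_vector set \<Rightarrow> ('a \<Rightarrow> 'b::real_normed_vector) \<Rightarrow> bool" where
  "Ck_on 0 S f \<longleftrightarrow> continuous_on S f"
| "Ck_on (Suc k) S f \<longleftrightarrow>
     f differentiable_on S \<and> (\<forall>v. Ck_on k S (\<lambda>x. frechet_derivative f (at x) v))"

definition smooth_on :: "'a::real_normed_vector set \<Rightarrow> ('a \<Rightarrow> 'b::real_normed_vector) \<Rightarrow> bool" where
  "smooth_on S f \<longleftrightarrow> (\<forall>k. Ck_on k S f)"

text \<open>A chart is a pair of its domain and its coordinate map; an atlas is a set of charts.\<close>

type_synonym 'a chart = "'a set \<times> ('a \<Rightarrow> real^2)"

definition is_chart :: "'a topology \<Rightarrow> 'a chart \<Rightarrow> bool" where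
  "is_chart X = (\<lambda>(U, c). openin X U \<and> open (c ` U) \<and>
     homeomorphic_map (subtopology X U) (top_of_set (c ` U)) c)"

definition local_rep :: "'a chart \<Rightarrow> ('a \<Rightarrow> 'b) \<Rightarrow> real^2 \<Rightarrow> 'b" where
  "local_rep = (\<lambda>(U, c) G. G \<circ> inv_into U c)"

definition smooth_map_on ::
    "'a chart set \<Rightarrow> 'a set \<Rightarrow> ('a \<Rightarrow> 'b::real_normed_vector) \<Rightarrow> bool" where
  "smooth_map_on A W G \<longleftrightarrow> (\<forall>(U, c)\<in>A. smooth_on (c ` (U \<inter> W)) (local_rep (U, c) G))"

definition smooth_surface :: "'a topology \<Rightarrow> 'a chart set \<Rightarrow> bool" where
  "smooth_surface X A \<longleftrightarrow>
     Hausdorff_space X \<and> second_countable X \<and> (\<Union>(U, c)\<in>A. U) = topspace X \<and>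
     (\<forall>\<kappa>\<in>A. is_chart X \<kappa>) \<and>
     (\<forall>(V, d)\<in>A. smooth_map_on A V d)"

text \<open>Charts take values in open subsets of the plane, so there is no boundary.\<close>

definition closed_surface :: "'a topology \<Rightarrow> 'a chart set \<Rightarrow> bool" where
  "closed_surface X A \<longleftrightarrow> smooth_surface X A \<and> connected_space X \<and> compact_space X"

section \<open>The space forms of nonpositive curvature\<close>

text \<open>
  Both kinds of space form are spacelike hypersurfaces of four-dimensional Minkowski space: for
  \<open>\<rho> < 0\<close> the hyperboloid model of hyperbolic space, for \<open>\<rho> = 0\<close> the slice \<open>t = 0\<close>, which is
  a copy of \<open>\<real>\<^sup>3\<close> with its Euclidean metric. The Riemannian metric is the restriction of
  \<open>lorentz\<close> to the tangent spaces. The definitions are meaningful for \<open>\<rho> \<le> 0\<close> only.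
\<close>

type_synonym minkowski = "real \<times> (real^3)"

definition lorentz :: "minkowski \<Rightarrow> minkowski \<Rightarrow> real" where
  "lorentz v w = snd v \<bullet> snd w - fst v * fst w"

definition space_form :: "real \<Rightarrow> minkowski set" where
  "space_form \<rho> = (if \<rho> = 0 then {z. fst z = 0} else {z. lorentz z z = 1 / \<rho> \<and> fst z > 0})"

definition space_form_tangent :: "real \<Rightarrow> minkowski \<Rightarrow> minkowski set" where
  "space_form_tangent \<rho> z = (if \<rho> = 0 then {v. fst v = 0} else {v. lorentz z v = 0})"

text \<open>
  The Levi-Civita connection of a hypersurface of Minkowski space is the tangential part of the
  flat derivative. Since \<open>lorentz z z = 1 / \<rho>\<close> for \<open>\<rho> < 0\<close>, the tangential part of \<open>w\<close> at
  \<open>z\<close> is \<open>w - \<rho> * lorentz z w * z\<close>. For \<open>\<rho> = 0\<close> this is \<open>w\<close>, as it should be: derivatives of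
  vector fields tangent to the slice are tangent to the slice.
  \<open>cov_deriv \<rho> f Y x v\<close> is the covariant derivative in direction \<open>v\<close> of the vector field \<open>Y\<close>
  along \<open>f\<close>.
\<close>

definition cov_deriv ::
    "real \<Rightarrow> (real^2 \<Rightarrow> minkowski) \<Rightarrow> (real^2 \<Rightarrow> minkowski) \<Rightarrow> real^2 \<Rightarrow> real^2 \<Rightarrow> minkowski" where
  "cov_deriv \<rho> f Y x v =
     (let w = frechet_derivative Y (at x) v in w - (\<rho> * lorentz (f x) w) *\<^sub>R f x)"

section \<open>Geometry of a parametrized surface patch\<close>

text \<open>
  In the following, \<open>f\<close> is an immersed patch and \<open>\<nu>\<close> a unit normal field along it. Tangent vectors
  of the surface are given by their coordinates in \<open>\<real>\<^sup>2\<close>; the surface carries the metric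
  that makes the immersion isometric.
\<close>

definition induced_metric :: "(real^2 \<Rightarrow> minkowski) \<Rightarrow> real^2 \<Rightarrow> real^2 \<Rightarrow> real^2 \<Rightarrow> real" where
  "induced_metric f x v w =
     lorentz (frechet_derivative f (at x) v) (frechet_derivative f (at x) w)"

text \<open>The Weingarten formula; \<open>w\<close> exists as \<open>\<nu>\<close> has constant length, and is unique as \<open>f\<close> is an
  immersion.\<close>

definition shape_operator ::
    "real \<Rightarrow> (real^2 \<Rightarrow> minkowski) \<Rightarrow> (real^2 \<Rightarrow> minkowski) \<Rightarrow> real^2 \<Rightarrow> real^2 \<Rightarrow> real^2" where
  "shape_operator \<rho> f \<nu> x v = (THE w. frechet_derivative f (at x) w = - cov_deriv \<rho> f \<nu> x v)"

definition mean_curvature ::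
    "real \<Rightarrow> (real^2 \<Rightarrow> minkowski) \<Rightarrow> (real^2 \<Rightarrow> minkowski) \<Rightarrow> real^2 \<Rightarrow> real" where
  "mean_curvature \<rho> f \<nu> x = trace (matrix (shape_operator \<rho> f \<nu> x)) / 2"

definition surface_grad :: "(real^2 \<Rightarrow> minkowski) \<Rightarrow> (real^2 \<Rightarrow> real) \<Rightarrow> real^2 \<Rightarrow> real^2" where
  "surface_grad f h x =
     (THE w. \<forall>v. induced_metric f x w v = frechet_derivative h (at x) v)"

definition biconservative_at ::
    "real \<Rightarrow> (real^2 \<Rightarrow> minkowski) \<Rightarrow> (real^2 \<Rightarrow> minkowski) \<Rightarrow> real^2 \<Rightarrow> bool" where
  "biconservative_at \<rho> f \<nu> x \<longleftrightarrow>
     (let H = mean_curvature \<rho> f \<nu>; G = surface_grad f H x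
      in 2 *\<^sub>R shape_operator \<rho> f \<nu> x G + (2 * H x) *\<^sub>R G = 0)"

section \<open>Immersed surfaces\<close>

definition immersion ::
    "real \<Rightarrow> 'a topology \<Rightarrow> 'a chart set \<Rightarrow> ('a \<Rightarrow> minkowski) \<Rightarrow> bool" where
  "immersion \<rho> X A F \<longleftrightarrow>
     F ` topspace X \<subseteq> space_form \<rho> \<and> smooth_map_on A (topspace X) F \<and>
     (\<forall>(U, c)\<in>A. \<forall>x\<in>c ` U. inj (frechet_derivative (local_rep (U, c) F) (at x)))"

text \<open>
  A smooth unit normal field on an open set \<open>W\<close> of the surface. Working with local fields covers
  one-sided surfaces as well; on a two-sided surface \<open>W\<close> may be the whole surface.
\<close>

definition unit_normal ::
    "real \<Rightarrow> 'a topology \<Rightarrow> 'a chart set \<Rightarrow> ('a \<Rightarrow> minkowski) \<Rightarrow> 'a set \<Rightarrow> ('a \<Rightarrow> minkowski) \<Rightarrow> bool"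
  where
  "unit_normal \<rho> X A F W \<eta> \<longleftrightarrow>
     openin X W \<and> smooth_map_on A W \<eta> \<and>
     (\<forall>p\<in>W. \<eta> p \<in> space_form_tangent \<rho> (F p) \<and> lorentz (\<eta> p) (\<eta> p) = 1) \<and>
     (\<forall>(U, c)\<in>A. \<forall>p\<in>U \<inter> W. \<forall>v.
        lorentz (\<eta> p) (frechet_derivative (local_rep (U, c) F) (at (c p)) v) = 0)"

definition biconservative ::
    "real \<Rightarrow> 'a topology \<Rightarrow> 'a chart set \<Rightarrow> ('a \<Rightarrow> minkowski) \<Rightarrow> bool" where
  "biconservative \<rho> X A F \<longleftrightarrow>
     (\<forall>W \<eta>. unit_normal \<rho> X A F W \<eta> \<longrightarrow>
        (\<forall>(U, c)\<in>A. \<forall>p\<in>U \<inter> W.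
           biconservative_at \<rho> (local_rep (U, c) F) (local_rep (U, c) \<eta>) (c p)))"

text \<open>
  The mean curvature function is constant on every connected open set that carries a unit normal
  field. Its value at a point does not depend on the chart; changing the sign of the
  normal changes the sign of the mean curvature, hence the connectedness.
\<close>

definition cmc ::
    "real \<Rightarrow> 'a topology \<Rightarrow> 'a chart set \<Rightarrow> ('a \<Rightarrow> minkowski) \<Rightarrow> bool" where
  "cmc \<rho> X A F \<longleftrightarrow>
     (\<forall>W \<eta>. unit_normal \<rho> X A F W \<eta> \<and> connectedin X W \<longrightarrow>
        (\<exists>H. \<forall>(U, c)\<in>A. \<forall>p\<in>U \<inter> W.
           mean_curvature \<rho> (local_rep (U, c) F) (local_rep (U, c) \<eta>) (c p) = H))"

end

theory Submission
  imports Defs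
begin

text \<open>
  Biconservativity says that \<open>grad H\<close> is an eigenvector of the shape operator for the eigenvalue
  \<open>- H\<close> wherever it does not vanish; the other principal curvature is then \<open>3 H\<close>. The Codazzi and
  Gauss equations turn this into an identity for the derivative of \<open>|grad H|\<^sup>2\<close>, which can be
  integrated: with \<open>h = H\<^sup>2\<close>, the function
  \<open>9/64 |grad h|\<^sup>2 h\<^sup>-\<^sup>1\<^sup>1\<^sup>/\<^sup>4 + 9 h\<^sup>1\<^sup>/\<^sup>4 + \<rho> h\<^sup>-\<^sup>3\<^sup>/\<^sup>4\<close> is locally constant on \<open>{h > 0}\<close>. Hence
  \<open>|grad h|\<close> is bounded there by a multiple of \<open>h\<close>, so that \<open>h\<close> vanishes nowhere unless it vanishes
  identically. At the extrema of \<open>h\<close> the gradient term drops out, and for \<open>\<rho> \<le> 0\<close> the rest is a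
  strictly increasing function of \<open>h\<close>. So the maximum and the minimum of \<open>h\<close> coincide.
\<close>


section \<open>Smooth maps\<close>

text \<open>The exponents come from an ODE. Where \<open>H > 0\<close> and
  \<open>grad H \<noteq> 0\<close>, Codazzi with the principal curvatures \<open>- H\<close> and
  \<open>3 H\<close> gives the level curves geodesic curvature \<open>3 |grad H| / (4 H)\<close> up
  to sign, so their lengths scale like \<open>r = H powr (-3/4)\<close>. Gauss then reads
  \<open>r'' = (3 H^2 - \<rho>) r\<close> in arc length across the level curves; multiplying by
  \<open>2 r'\<close> and integrating gives the first integral.

  The obstacle is that critical points of \<open>H\<close> might fill open sets, and a frame built
  on \<open>grad H\<close> is lost there. So no field is normalised, and the identities are
  multiplied out until both sides vanish at critical points; they then hold on whole charts. The
  square of \<open>H\<close> is used since \<open>H\<close> changes sign with the normal and a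
  one-sided surface has no global normal.

  Both kinds of space form sit in Minkowski space, so Codazzi and Gauss reduce to the symmetry of
  second derivatives of vector-valued maps; neither Christoffel symbols nor a curvature tensor
  appear.\<close>

abbreviation fd :: "('a::real_normed_vector \<Rightarrow> 'b::real_normed_vector) \<Rightarrow> 'a \<Rightarrow> 'a \<Rightarrow> 'b"
  where "fd f x \<equiv> frechet_derivative f (at x)"

lemma fd_eqI: "(f has_derivative f') (at x) \<Longrightarrow> fd f x = f'"
  by (metis frechet_derivative_at)

lemma fd_cong:
  assumes "open S" "x \<in> S" "\<And>y. y \<in> S \<Longrightarrow> f y = g y"
  shows "fd f x = fd g x"
  unfolding frechet_derivative_def
  using has_derivative_transform_within_open[OF _ assms(1,2)] assms(3) by metis

lemma differentiable_on_openD: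
  "f differentiable_on S \<Longrightarrow> open S \<Longrightarrow> x \<in> S \<Longrightarrow> (f has_derivative fd f x) (at x)"
  by (metis differentiable_on_eq_differentiable_at frechet_derivative_works)

lemma differentiable_on_openI:
  "(\<And>x. x \<in> S \<Longrightarrow> (f has_derivative f' x) (at x)) \<Longrightarrow> f differentiable_on S"
  by (meson differentiable_at_imp_differentiable_on differentiableI)

lemma differentiable_on_cong_open:
  assumes "open S" "f differentiable_on S" "\<And>y. y \<in> S \<Longrightarrow> f y = g y"
  shows "g differentiable_on S"
  using differentiable_on_openD[OF assms(2,1)] assms
  by (intro differentiable_on_openI[where f' = "fd f"])
    (auto intro: has_derivative_transform_within_open)

lemma Ck_on_cong:
  assumes "open S" "\<And>x. x \<in> S \<Longrightarrow> f x = g x" "Ck_on k S f"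
  shows "Ck_on k S g"
  using assms(2,3)
proof (induction k arbitrary: f g)
  case 0
  then show ?case by (metis Ck_on.simps(1) continuous_on_cong)
next
  case (Suc k)
  have "Ck_on k S (\<lambda>x. fd g x v)" for v
  proof (rule Suc.IH)
    show "fd f x v = fd g x v" if "x \<in> S" for x
      using fd_cong[OF assms(1) that Suc.prems(1)] by simp
  qed (use Suc.prems in auto)
  then show ?case using Suc.prems differentiable_on_cong_open[OF assms(1)] by auto
qed

lemma Ck_on_subset: "T \<subseteq> S \<Longrightarrow> Ck_on k S f \<Longrightarrow> Ck_on k T f"
  by (induction k arbitrary: f) (auto intro: continuous_on_subset differentiable_on_subset)

lemma Ck_on_SucD: "Ck_on (Suc k) S f \<Longrightarrow> Ck_on k S f"
  by (induction k arbitrary: f) (auto simp: differentiable_imp_continuous_on)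

lemma Ck_on_const: "Ck_on k S (\<lambda>_. c)"
  by (induction k arbitrary: c) auto

lemma Ck_on_add:
  assumes "open S"
  shows "Ck_on k S f \<Longrightarrow> Ck_on k S g \<Longrightarrow> Ck_on k S (\<lambda>x. f x + g x)"
proof (induction k arbitrary: f g)
  case (Suc k)
  have d: "((\<lambda>x. f x + g x) has_derivative (\<lambda>v. fd f x v + fd g x v)) (at x)" if "x \<in> S" for x
    using differentiable_on_openD[OF _ assms that] Suc.prems by (auto intro!: derivative_intros)
  have "Ck_on k S (\<lambda>x. fd (\<lambda>x. f x + g x) x v)" for v
    by (rule Ck_on_cong[OF assms _ Suc.IH[of "\<lambda>x. fd f x v" "\<lambda>x. fd g x v"]])
      (use Suc.prems fd_eqI[OF d] in auto)
  then show ?case using differentiable_on_openI[OF d] by simp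
qed (auto intro: continuous_intros)

lemma Ck_on_linear:
  assumes "open S" "bounded_linear L"
  shows "Ck_on k S f \<Longrightarrow> Ck_on k S (\<lambda>x. L (f x))"
proof (induction k arbitrary: f)
  case 0
  then show ?case using assms(2) by (auto intro: bounded_linear.continuous_on)
next
  case (Suc k)
  have d: "((\<lambda>x. L (f x)) has_derivative (\<lambda>v. L (fd f x v))) (at x)" if "x \<in> S" for x
    using bounded_linear.has_derivative[OF assms(2) differentiable_on_openD[OF _ assms(1) that]] Suc.prems
    by auto
  have "Ck_on k S (\<lambda>x. fd (\<lambda>x. L (f x)) x v)" for v
    by (rule Ck_on_cong[OF assms(1) _ Suc.IH[of "\<lambda>x. fd f x v"]])
      (use Suc.prems fd_eqI[OF d] in auto)
  then show ?case using differentiable_on_openI[OF d] by simp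
qed

text \<open>A single product rule serves multiplication, scaling, \<open>inner\<close>,
  \<open>lorentz\<close> and \<open>cross3\<close>. The induction closes because the derivative is a
  sum of two such products, each pairing a derivative with an undifferentiated factor.\<close>

lemma Ck_on_bilinear:
  assumes "open S" "bounded_bilinear B"
  shows "Ck_on k S f \<Longrightarrow> Ck_on k S g \<Longrightarrow> Ck_on k S (\<lambda>x. B (f x) (g x))"
proof (induction k arbitrary: f g)
  case 0
  then show ?case using assms(2) by (auto intro: bounded_bilinear.continuous_on)
next
  case (Suc k)
  have d: "((\<lambda>x. B (f x) (g x)) has_derivative (\<lambda>v. B (f x) (fd g x v) + B (fd f x v) (g x))) (at x)"
    if "x \<in> S" for x
    using bounded_bilinear.FDERIV[OF assms(2) differentiable_on_openD[OF _ assms(1) that]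
      differentiable_on_openD[OF _ assms(1) that]] Suc.prems by auto
  have "Ck_on k S (\<lambda>x. fd (\<lambda>x. B (f x) (g x)) x v)" for v
  proof (rule Ck_on_cong[OF assms(1)])
    show "Ck_on k S (\<lambda>x. B (f x) (fd g x v) + B (fd f x v) (g x))"
      using Suc.prems Ck_on_SucD[OF Suc.prems(1)] Ck_on_SucD[OF Suc.prems(2)]
      by (intro Ck_on_add[OF assms(1)] Suc.IH) auto
  qed (use fd_eqI[OF d] in auto)
  then show ?case using differentiable_on_openI[OF d] by simp
qed

lemma Ck_on_sum:
  assumes "open S" "\<And>i. i \<in> I \<Longrightarrow> Ck_on k S (f i)"
  shows "Ck_on k S (\<lambda>x. \<Sum>i\<in>I. f i x)"
  using assms(2)
  by (induction I rule: infinite_finite_induct) (auto intro: Ck_on_const Ck_on_add[OF assms(1)])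

lemma linear_euclidean_expand:
  fixes L :: "'a::euclidean_space \<Rightarrow> 'b::real_vector"
  assumes "linear L"
  shows "L v = (\<Sum>b\<in>Basis. (v \<bullet> b) *\<^sub>R L b)"
proof -
  have "L v = L (\<Sum>b\<in>Basis. (v \<bullet> b) *\<^sub>R b)" by (simp add: euclidean_representation)
  also have "\<dots> = (\<Sum>b\<in>Basis. (v \<bullet> b) *\<^sub>R L b)"
    by (simp add: linear_sum[OF assms] linear_scale[OF assms])
  finally show ?thesis .
qed

text \<open>\<open>Ck_on\<close> speaks of derivatives in fixed directions only, whereas the chain
  rule differentiates \<open>g\<close> in the direction \<open>fd f x v\<close>, which moves with
  \<open>x\<close>. Expanding that direction in the basis leaves fixed directions with smooth
  coefficients.\<close>

lemma Ck_on_compose: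
  fixes f :: "'a::real_normed_vector \<Rightarrow> 'b::euclidean_space"
    and g :: "'b \<Rightarrow> 'c::real_normed_vector"
  assumes "open S" "open T" "\<And>x. x \<in> S \<Longrightarrow> f x \<in> T"
  shows "Ck_on k S f \<Longrightarrow> Ck_on k T g \<Longrightarrow> Ck_on k S (\<lambda>x. g (f x))"
proof (induction k arbitrary: g)
  case 0
  then show ?case
    using assms(3) by (auto intro!: continuous_on_compose2[of T g S f])
next
  case (Suc k)
  have d: "((\<lambda>x. g (f x)) has_derivative (\<lambda>v. fd g (f x) (fd f x v))) (at x)" if "x \<in> S" for x
    using has_derivative_compose[of f "fd f x" x S g "fd g (f x)"]
      has_derivative_compose[of f "fd f x" x UNIV g "fd g (f x)"] Suc.prems
      differentiable_on_openD[OF _ assms(1) that] differentiable_on_openD[OF _ assms(2) assms(3)[OF that]]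
    by auto
  have e: "fd (\<lambda>x. g (f x)) x v = (\<Sum>b\<in>Basis. (fd f x v \<bullet> b) *\<^sub>R fd g (f x) b)" if "x \<in> S" for x v
  proof -
    have "linear (fd g (f x))"
      using Suc.prems(2) assms that
      by (intro linear_frechet_derivative) (auto simp: differentiable_on_eq_differentiable_at)
    then show ?thesis using fd_eqI[OF d[OF that]] linear_euclidean_expand by metis
  qed
  have "Ck_on k S (\<lambda>x. fd (\<lambda>x. g (f x)) x v)" for v
  proof (rule Ck_on_cong[OF assms(1)])
    show "Ck_on k S (\<lambda>x. \<Sum>b\<in>Basis. (fd f x v \<bullet> b) *\<^sub>R fd g (f x) b)"
      using Suc.prems Ck_on_SucD[OF Suc.prems(1)]
      by (intro Ck_on_sum Ck_on_bilinear[OF assms(1) bounded_bilinear_scaleR] Suc.IH assms(1)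
          Ck_on_linear[OF _ bounded_linear_inner_left]) auto
  qed (use e in auto)
  then show ?case using differentiable_on_openI[OF d] by simp
qed

text \<open>The factor \<open>c\<close> is there for the induction: the derivative has the same form
  with other values of \<open>c\<close> and \<open>a\<close>.\<close>

lemma Ck_on_powr: "Ck_on k {0<..} (\<lambda>x::real. c * x powr a)"
proof (induction k arbitrary: c a)
  case 0
  then show ?case by (auto intro!: continuous_intros)
next
  case (Suc k)
  have d: "((\<lambda>x. c * x powr a) has_derivative (\<lambda>v. (c * a * v) * x powr (a - 1))) (at x)" if "x > 0" for x
    using that by (auto intro!: derivative_eq_intros simp: powr_diff field_simps)
  have "Ck_on k {0<..} (\<lambda>x. fd (\<lambda>x. c * x powr a) x v)" for v
    by (rule Ck_on_cong[OF _ _ Suc.IH[of "c * a * v" "a - 1"]]) (use fd_eqI[OF d] in auto)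
  then show ?case using differentiable_on_openI[of "{0<..}", OF d] by simp
qed

lemma smooth_on_cong:
  "open S \<Longrightarrow> smooth_on S f \<Longrightarrow> (\<And>x. x \<in> S \<Longrightarrow> f x = g x) \<Longrightarrow> smooth_on S g"
  unfolding smooth_on_def using Ck_on_cong by metis

lemma smooth_on_subset: "smooth_on S f \<Longrightarrow> T \<subseteq> S \<Longrightarrow> smooth_on T f"
  unfolding smooth_on_def using Ck_on_subset by blast

lemma smooth_on_const: "smooth_on S (\<lambda>_. c)"
  unfolding smooth_on_def using Ck_on_const by blast

lemma smooth_on_add: "open S \<Longrightarrow> smooth_on S f \<Longrightarrow> smooth_on S g \<Longrightarrow> smooth_on S (\<lambda>x. f x + g x)"
  unfolding smooth_on_def using Ck_on_add by blast

lemma smooth_on_linear: "open S \<Longrightarrow> bounded_linear L \<Longrightarrow> smooth_on S f \<Longrightarrow> smooth_on S (\<lambda>x. L (f x))"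
  unfolding smooth_on_def using Ck_on_linear by blast

lemma smooth_on_bilinear:
  "open S \<Longrightarrow> bounded_bilinear B \<Longrightarrow> smooth_on S f \<Longrightarrow> smooth_on S g \<Longrightarrow> smooth_on S (\<lambda>x. B (f x) (g x))"
  unfolding smooth_on_def using Ck_on_bilinear by blast

lemmas smooth_on_mult = smooth_on_bilinear[OF _ bounded_bilinear_mult]
lemmas smooth_on_scaleR = smooth_on_bilinear[OF _ bounded_bilinear_scaleR]
lemmas smooth_on_inner = smooth_on_bilinear[OF _ bounded_bilinear_inner]
lemmas smooth_on_fst = smooth_on_linear[OF _ bounded_linear_fst]
lemmas smooth_on_snd = smooth_on_linear[OF _ bounded_linear_snd]
lemmas smooth_on_minus = smooth_on_linear[OF _ bounded_linear_minus[OF bounded_linear_ident]]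
lemmas smooth_on_nth = smooth_on_linear[OF _ bounded_linear_vec_nth]

lemma smooth_on_diff:
  "open S \<Longrightarrow> smooth_on S f \<Longrightarrow> smooth_on S g \<Longrightarrow> smooth_on S (\<lambda>x. f x - g x)"
  using smooth_on_add[of S f "\<lambda>x. - g x"] smooth_on_minus[of S g] by simp

lemma smooth_on_Pair:
  assumes "open S" "smooth_on S f" "smooth_on S g"
  shows "smooth_on S (\<lambda>x. (f x, g x))"
proof -
  have "smooth_on S (\<lambda>x. (f x, 0) + (0, g x))"
    by (intro smooth_on_add assms smooth_on_linear[OF assms(1), of "\<lambda>y. (y, 0)"]
        smooth_on_linear[OF assms(1), of "\<lambda>y. (0, y)"] bounded_linear_Pair
        bounded_linear_ident bounded_linear_zero)
  then show ?thesis by simp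
qed

lemma smooth_on_compose:
  fixes f :: "'a::real_normed_vector \<Rightarrow> 'b::euclidean_space"
  assumes "open S" "open T" "\<And>x. x \<in> S \<Longrightarrow> f x \<in> T" "smooth_on S f" "smooth_on T g"
  shows "smooth_on S (\<lambda>x. g (f x))"
  using assms(4,5) Ck_on_compose[of S T f, OF assms(1-3)] unfolding smooth_on_def by blast

lemma smooth_on_powr:
  fixes f :: "'a::real_normed_vector \<Rightarrow> real"
  assumes "open S" "smooth_on S f" "\<And>x. x \<in> S \<Longrightarrow> f x > 0"
  shows "smooth_on S (\<lambda>x. f x powr a)"
proof (rule smooth_on_compose[where T = "{0<..}" and g = "\<lambda>x. x powr a"])
  show "smooth_on {0<..} (\<lambda>x. x powr a)"
    using Ck_on_powr[of _ 1 a] by (simp add: smooth_on_def)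
qed (use assms in auto)

lemma smooth_on_divide:
  assumes "open S" "smooth_on S f" "smooth_on S g" "\<And>x. x \<in> S \<Longrightarrow> g x > 0"
  shows "smooth_on S (\<lambda>x. f x / g x :: real)"
proof (rule smooth_on_cong[OF assms(1)])
  show "smooth_on S (\<lambda>x. f x * g x powr (-1))"
    by (intro smooth_on_mult smooth_on_powr assms)
  show "f x * g x powr (-1) = f x / g x" if "x \<in> S" for x
    using assms(4)[OF that] by (simp add: powr_minus divide_inverse)
qed

lemma smooth_on_fd: "smooth_on S f \<Longrightarrow> smooth_on S (\<lambda>x. fd f x v)"
  unfolding smooth_on_def by (metis Ck_on.simps(2))

lemma smooth_on_imp_differentiable_on: "smooth_on S f \<Longrightarrow> f differentiable_on S"
  unfolding smooth_on_def by (metis Ck_on.simps(2))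

lemma smooth_on_has_derivative:
  "smooth_on S f \<Longrightarrow> open S \<Longrightarrow> x \<in> S \<Longrightarrow> (f has_derivative fd f x) (at x)"
  using differentiable_on_openD smooth_on_imp_differentiable_on by blast

lemma smooth_on_imp_continuous_on: "smooth_on S f \<Longrightarrow> continuous_on S f"
  unfolding smooth_on_def by (metis Ck_on.simps(1))

lemma smooth_on_linear_fd: "smooth_on S f \<Longrightarrow> open S \<Longrightarrow> x \<in> S \<Longrightarrow> linear (fd f x)"
  using smooth_on_has_derivative has_derivative_linear by blast

lemma fd_compose:
  assumes "smooth_on S f" "open S" "x \<in> S" "smooth_on T g" "open T" "f x \<in> T"
  shows "fd (\<lambda>x. g (f x)) x v = fd g (f x) (fd f x v)"
  using fd_eqI[OF has_derivative_compose[OF smooth_on_has_derivative[OF assms(1-3)]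
    smooth_on_has_derivative[OF assms(4-6)]]] by simp

subsection \<open>Symmetry of the second derivative\<close>

text \<open>The mean value theorem is applied twice, along \<open>u\<close> to the increment in
  \<open>v\<close> and then along \<open>v\<close>. The left-hand side is symmetric in
  \<open>u\<close> and \<open>v\<close>, which yields the symmetry of the second derivative.\<close>

lemma second_difference:
  fixes \<phi> :: "'a::real_normed_vector \<Rightarrow> real"
  assumes "Ck_on 2 S \<phi>" "open S" "h > 0"
    and sub: "\<And>s t. 0 \<le> s \<Longrightarrow> s \<le> h \<Longrightarrow> 0 \<le> t \<Longrightarrow> t \<le> h \<Longrightarrow> x + s *\<^sub>R u + t *\<^sub>R v \<in> S"
  obtains s t where "0 < s" "s < h" "0 < t" "t < h"
    "\<phi> (x + h *\<^sub>R u + h *\<^sub>R v) - \<phi> (x + h *\<^sub>R u) - \<phi> (x + h *\<^sub>R v) + \<phi> x =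
     h\<^sup>2 * fd (\<lambda>y. fd \<phi> y u) (x + s *\<^sub>R u + t *\<^sub>R v) v"
proof -
  have c1: "\<phi> differentiable_on S" and c2: "(\<lambda>y. fd \<phi> y u) differentiable_on S"
    using assms(1) by (auto simp: numeral_2_eq_2)
  have d1: "((\<lambda>s. \<phi> (x + s *\<^sub>R u + t *\<^sub>R v)) has_derivative (\<lambda>r. r * fd \<phi> (x + s *\<^sub>R u + t *\<^sub>R v) u)) (at s)"
    if "0 \<le> s" "s \<le> h" "0 \<le> t" "t \<le> h" for s t
  proof -
    have D: "(\<phi> has_derivative fd \<phi> (x + s *\<^sub>R u + t *\<^sub>R v)) (at (x + s *\<^sub>R u + t *\<^sub>R v))"
      using differentiable_on_openD[OF c1 assms(2) sub[OF that]] .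
    have E: "((\<lambda>s. x + s *\<^sub>R u + t *\<^sub>R v) has_derivative (\<lambda>r. r *\<^sub>R u)) (at s)"
      by (auto intro!: derivative_eq_intros)
    show ?thesis
      using has_derivative_compose[OF E D] linear_scale[OF has_derivative_linear[OF D]] by simp
  qed
  have d2: "((\<lambda>t. fd \<phi> (x + s *\<^sub>R u + t *\<^sub>R v) u) has_derivative
      (\<lambda>r. r * fd (\<lambda>y. fd \<phi> y u) (x + s *\<^sub>R u + t *\<^sub>R v) v)) (at t)"
    if "0 \<le> s" "s \<le> h" "0 \<le> t" "t \<le> h" for s t
  proof -
    have D: "((\<lambda>y. fd \<phi> y u) has_derivative fd (\<lambda>y. fd \<phi> y u) (x + s *\<^sub>R u + t *\<^sub>R v)) (at (x + s *\<^sub>R u + t *\<^sub>R v))"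
      using differentiable_on_openD[OF c2 assms(2) sub[OF that]] .
    have E: "((\<lambda>t. x + s *\<^sub>R u + t *\<^sub>R v) has_derivative (\<lambda>r. r *\<^sub>R v)) (at t)"
      by (auto intro!: derivative_eq_intros)
    show ?thesis
      using has_derivative_compose[OF E D] linear_scale[OF has_derivative_linear[OF D]] by simp
  qed
  have "\<exists>s. 0 < s \<and> s < h \<and> (\<phi> (x + h *\<^sub>R u + h *\<^sub>R v) - \<phi> (x + h *\<^sub>R u + 0 *\<^sub>R v))
       - (\<phi> (x + 0 *\<^sub>R u + h *\<^sub>R v) - \<phi> (x + 0 *\<^sub>R u + 0 *\<^sub>R v))
      = (h - 0) * (fd \<phi> (x + s *\<^sub>R u + h *\<^sub>R v) u - fd \<phi> (x + s *\<^sub>R u + 0 *\<^sub>R v) u)"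
  proof (rule MVT2)
    show "0 < h" by fact
    show "((\<lambda>s. \<phi> (x + s *\<^sub>R u + h *\<^sub>R v) - \<phi> (x + s *\<^sub>R u + 0 *\<^sub>R v)) has_real_derivative
        fd \<phi> (x + s *\<^sub>R u + h *\<^sub>R v) u - fd \<phi> (x + s *\<^sub>R u + 0 *\<^sub>R v) u) (at s)"
      if "0 \<le> s" "s \<le> h" for s
      using has_derivative_diff[OF d1[OF that, of h] d1[OF that, of 0]] assms(3)
      unfolding has_field_derivative_def by (auto simp: algebra_simps fun_eq_iff elim!: has_derivative_eq_rhs)
  qed
  then obtain s where s: "0 < s" "s < h" and e1: "\<phi> (x + h *\<^sub>R u + h *\<^sub>R v) - \<phi> (x + h *\<^sub>R u)
       - \<phi> (x + h *\<^sub>R v) + \<phi> x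
      = h * (fd \<phi> (x + s *\<^sub>R u + h *\<^sub>R v) u - fd \<phi> (x + s *\<^sub>R u + 0 *\<^sub>R v) u)" by auto
  have "\<exists>t. 0 < t \<and> t < h \<and> fd \<phi> (x + s *\<^sub>R u + h *\<^sub>R v) u - fd \<phi> (x + s *\<^sub>R u + 0 *\<^sub>R v) u
      = (h - 0) * fd (\<lambda>y. fd \<phi> y u) (x + s *\<^sub>R u + t *\<^sub>R v) v"
  proof (rule MVT2)
    show "0 < h" by fact
    show "((\<lambda>t. fd \<phi> (x + s *\<^sub>R u + t *\<^sub>R v) u) has_real_derivative
        fd (\<lambda>y. fd \<phi> y u) (x + s *\<^sub>R u + t *\<^sub>R v) v) (at t)"
      if "0 \<le> t" "t \<le> h" for t
      using d2[of s t] s that unfolding has_field_derivative_def by (auto simp: mult.commute fun_eq_iff elim!: has_derivative_eq_rhs)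
  qed
  then obtain t where t: "0 < t" "t < h" "fd \<phi> (x + s *\<^sub>R u + h *\<^sub>R v) u - fd \<phi> (x + s *\<^sub>R u + 0 *\<^sub>R v) u
      = h * fd (\<lambda>y. fd \<phi> y u) (x + s *\<^sub>R u + t *\<^sub>R v) v" by auto
  show thesis
    by (rule that[OF s t(1,2)]) (use e1 t(3) in \<open>simp add: power2_eq_square\<close>)
qed

text \<open>Both mixed derivatives, at suitable points near \<open>x\<close>, equal the same second
  difference over \<open>h^2\<close>. By continuity they cannot differ at \<open>x\<close>.\<close>

lemma second_derivative_symmetric_real:
  fixes \<phi> :: "'a::real_normed_vector \<Rightarrow> real"
  assumes "Ck_on 2 S \<phi>" "open S" "x \<in> S"
  shows "fd (\<lambda>y. fd \<phi> y u) x v = fd (\<lambda>y. fd \<phi> y v) x u"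
proof (rule ccontr)
  let ?A = "\<lambda>y. fd (\<lambda>y. fd \<phi> y u) y v" and ?B = "\<lambda>y. fd (\<lambda>y. fd \<phi> y v) y u"
  assume "?A x \<noteq> ?B x"
  then have pos: "0 < \<bar>?A x - ?B x\<bar> / 2" by simp
  have "continuous_on S ?A" "continuous_on S ?B"
    using assms(1) by (auto simp: numeral_2_eq_2)
  then have "isCont ?A x" "isCont ?B x"
    using assms(2,3) continuous_on_eq_continuous_at by blast+
  then have "\<forall>e>0. \<exists>d>0. \<forall>y. dist y x < d \<longrightarrow> dist (?A y) (?A x) < e"
    "\<forall>e>0. \<exists>d>0. \<forall>y. dist y x < d \<longrightarrow> dist (?B y) (?B x) < e"
    unfolding continuous_at_eps_delta by blast+
  from this(1)[rule_format, OF pos] this(2)[rule_format, OF pos]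
  obtain r1 r2 where r: "r1 > 0" "r2 > 0"
    "\<And>y. dist y x < r1 \<Longrightarrow> dist (?A y) (?A x) < \<bar>?A x - ?B x\<bar> / 2"
    "\<And>y. dist y x < r2 \<Longrightarrow> dist (?B y) (?B x) < \<bar>?A x - ?B x\<bar> / 2"
    by blast
  obtain r3 where r3: "r3 > 0" "ball x r3 \<subseteq> S" using assms(2,3) open_contains_ball by blast
  define r where "r = min r1 (min r2 r3)"
  \<comment> \<open>Small enough to keep the parallelogram with sides \<open>h u\<close> and
    \<open>h v\<close> in the ball of radius \<open>r\<close>; the summand 1 covers
    \<open>u = v = 0\<close>.\<close>
  define h where "h = r / (2 * (norm u + norm v + 1))"
  have rp: "r > 0" using r r3 by (simp add: r_def)
  have n: "norm u + norm v + 1 > 0" by (simp add: add_nonneg_pos)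
  have hp: "h > 0" using rp n by (simp add: h_def)
  have near: "dist (x + s *\<^sub>R u + t *\<^sub>R v) x < r" if "0 \<le> s" "s \<le> h" "0 \<le> t" "t \<le> h" for s t
  proof -
    have "norm (s *\<^sub>R u + t *\<^sub>R v) \<le> s * norm u + t * norm v"
      using that by (metis abs_of_nonneg norm_scaleR norm_triangle_ineq)
    also have "\<dots> \<le> h * norm u + h * norm v"
      using that by (intro add_mono mult_right_mono) auto
    also have "\<dots> < h * (2 * (norm u + norm v + 1))"
    proof -
      have "norm u + norm v < 2 * (norm u + norm v + 1)"
        using norm_ge_zero[of u] norm_ge_zero[of v] by argo
      then show ?thesis using hp by (metis distrib_left mult_strict_left_mono)
    qed
    also have "\<dots> = r" using n by (simp add: h_def)
    finally show ?thesis by (simp add: dist_norm add.assoc)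
  qed
  have near': "dist (x + s *\<^sub>R v + t *\<^sub>R u) x < r" if "0 \<le> s" "s \<le> h" "0 \<le> t" "t \<le> h" for s t
    using near[of t s] that by (simp add: add.assoc add.commute[of "s *\<^sub>R v"])
  have inS: "y \<in> S" if "dist y x < r" for y
    using that r3 by (auto simp: r_def dist_commute)
  obtain s t where 1: "0 < s" "s < h" "0 < t" "t < h"
    "\<phi> (x + h *\<^sub>R u + h *\<^sub>R v) - \<phi> (x + h *\<^sub>R u) - \<phi> (x + h *\<^sub>R v) + \<phi> x =
     h\<^sup>2 * ?A (x + s *\<^sub>R u + t *\<^sub>R v)"
    using second_difference[OF assms(1,2) hp] near inS by metis
  obtain s' t' where 2: "0 < s'" "s' < h" "0 < t'" "t' < h"
    "\<phi> (x + h *\<^sub>R v + h *\<^sub>R u) - \<phi> (x + h *\<^sub>R v) - \<phi> (x + h *\<^sub>R u) + \<phi> x =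
     h\<^sup>2 * ?B (x + s' *\<^sub>R v + t' *\<^sub>R u)"
    using second_difference[OF assms(1,2) hp] near' inS by metis
  have "\<phi> (x + h *\<^sub>R v + h *\<^sub>R u) = \<phi> (x + h *\<^sub>R u + h *\<^sub>R v)"
    by (simp add: add.assoc add.commute[of "h *\<^sub>R v"])
  then have "h\<^sup>2 * ?A (x + s *\<^sub>R u + t *\<^sub>R v) = h\<^sup>2 * ?B (x + s' *\<^sub>R v + t' *\<^sub>R u)"
    using 1(5) 2(5) by linarith
  then have "?A (x + s *\<^sub>R u + t *\<^sub>R v) = ?B (x + s' *\<^sub>R v + t' *\<^sub>R u)" using hp by simp
  moreover have "dist (?A (x + s *\<^sub>R u + t *\<^sub>R v)) (?A x) < \<bar>?A x - ?B x\<bar> / 2"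
    using r(3) near[of s t] 1 by (simp add: r_def)
  moreover have "dist (?B (x + s' *\<^sub>R v + t' *\<^sub>R u)) (?B x) < \<bar>?A x - ?B x\<bar> / 2"
    using r(4) near'[of s' t'] 2 by (simp add: r_def)
  ultimately show False unfolding dist_real_def by argo
qed

lemma second_derivative_symmetric:
  fixes \<phi> :: "'a::real_normed_vector \<Rightarrow> 'b::euclidean_space"
  assumes "smooth_on S \<phi>" "open S" "x \<in> S"
  shows "fd (\<lambda>y. fd \<phi> y u) x v = fd (\<lambda>y. fd \<phi> y v) x u"
proof (rule euclidean_eqI)
  fix b :: 'b
  have 1: "fd (\<lambda>y. \<psi> y \<bullet> b) y w = fd \<psi> y w \<bullet> b" if "smooth_on S \<psi>" "y \<in> S" for \<psi> y w
    using fd_eqI[OF bounded_linear.has_derivative[OF bounded_linear_inner_left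
      smooth_on_has_derivative[OF that(1) assms(2) that(2)]]] by simp
  have 2: "fd (\<lambda>y. fd (\<lambda>y. \<phi> y \<bullet> b) y u) x v = fd (\<lambda>y. fd \<phi> y u) x v \<bullet> b" for u v
  proof -
    have "fd (\<lambda>y. fd (\<lambda>y. \<phi> y \<bullet> b) y u) x v = fd (\<lambda>y. fd \<phi> y u \<bullet> b) x v"
      using fd_cong[OF assms(2,3), of "\<lambda>y. fd (\<lambda>y. \<phi> y \<bullet> b) y u" "\<lambda>y. fd \<phi> y u \<bullet> b"]
        1[OF assms(1)] by simp
    then show ?thesis using 1[OF smooth_on_fd[OF assms(1)] assms(3)] by simp
  qed
  have "smooth_on S (\<lambda>y. \<phi> y \<bullet> b)"
    by (rule smooth_on_linear[OF assms(2) bounded_linear_inner_left assms(1)])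
  then have "Ck_on 2 S (\<lambda>y. \<phi> y \<bullet> b)" by (simp add: smooth_on_def)
  from second_derivative_symmetric_real[OF this assms(2,3), of u v]
  show "fd (\<lambda>y. fd \<phi> y u) x v \<bullet> b = fd (\<lambda>y. fd \<phi> y v) x u \<bullet> b" by (simp add: 2)
qed

text \<open>The Lie bracket measures the failure of directional derivatives along vector fields to
  commute.\<close>

lemma bracket_commutator:
  fixes \<phi> :: "'a::euclidean_space \<Rightarrow> 'b::euclidean_space"
  assumes "smooth_on S \<phi>" "smooth_on S V" "smooth_on S W" "open S" "x \<in> S"
  shows "fd (\<lambda>y. fd \<phi> y (W y)) x (V x) - fd (\<lambda>y. fd \<phi> y (V y)) x (W x)
    = fd \<phi> x (fd W x (V x) - fd V x (W x))"
proof -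
  have lin: "linear (fd \<phi> y)" if "y \<in> S" for y
    using assms(1,4) that smooth_on_linear_fd by blast
  have db: "((\<lambda>y. fd \<phi> y b) has_derivative fd (\<lambda>y. fd \<phi> y b) x) (at x)" for b
    using smooth_on_has_derivative[OF smooth_on_fd[OF assms(1)] assms(4,5)] .
  have key: "fd (\<lambda>y. fd \<phi> y (Z y)) x u = fd \<phi> x (fd Z x u) + fd (\<lambda>y. fd \<phi> y (Z x)) x u"
    if Z: "smooth_on S Z" for Z u
  proof -
    let ?L = "\<lambda>u. \<Sum>b\<in>Basis. (Z x \<bullet> b) *\<^sub>R fd (\<lambda>y. fd \<phi> y b) x u"
    have dz: "(Z has_derivative fd Z x) (at x)"
      using smooth_on_has_derivative[OF Z assms(4,5)] .
    have "((\<lambda>y. \<Sum>b\<in>Basis. (Z y \<bullet> b) *\<^sub>R fd \<phi> y b) has_derivative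
      (\<lambda>u. \<Sum>b\<in>Basis. (Z x \<bullet> b) *\<^sub>R fd (\<lambda>y. fd \<phi> y b) x u + (fd Z x u \<bullet> b) *\<^sub>R fd \<phi> x b)) (at x)"
      by (intro has_derivative_sum has_derivative_scaleR has_derivative_inner_left dz db)
    then have "((\<lambda>y. fd \<phi> y (Z y)) has_derivative
      (\<lambda>u. \<Sum>b\<in>Basis. (Z x \<bullet> b) *\<^sub>R fd (\<lambda>y. fd \<phi> y b) x u + (fd Z x u \<bullet> b) *\<^sub>R fd \<phi> x b)) (at x)"
      by (rule has_derivative_transform_within_open[OF _ assms(4,5)])
        (rule linear_euclidean_expand[OF lin, symmetric])
    from fd_eqI[OF this]
    have "fd (\<lambda>y. fd \<phi> y (Z y)) x u = ?L u + (\<Sum>b\<in>Basis. (fd Z x u \<bullet> b) *\<^sub>R fd \<phi> x b)"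
      by (simp add: sum.distrib)
    also have "\<dots> = ?L u + fd \<phi> x (fd Z x u)"
      by (simp only: linear_euclidean_expand[OF lin[OF assms(5)], of "fd Z x u"])
    finally have e: "fd (\<lambda>y. fd \<phi> y (Z y)) x u = ?L u + fd \<phi> x (fd Z x u)" .
    have "((\<lambda>y. \<Sum>b\<in>Basis. (Z x \<bullet> b) *\<^sub>R fd \<phi> y b) has_derivative ?L) (at x)"
      by (intro has_derivative_sum has_derivative_scaleR_right db)
    then have "((\<lambda>y. fd \<phi> y (Z x)) has_derivative ?L) (at x)"
      by (rule has_derivative_transform_within_open[OF _ assms(4,5)])
        (rule linear_euclidean_expand[OF lin, symmetric])
    from fd_eqI[OF this] e show ?thesis by simp
  qed
  have "linear (fd \<phi> x)" using assms smooth_on_linear_fd by blast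
  then show ?thesis
    using key[OF assms(2)] key[OF assms(3)] second_derivative_symmetric[OF assms(1,4,5), of "V x" "W x"]
    by (simp add: linear_diff)
qed

text \<open>As in the chain rule, a moving direction is expanded in the basis.\<close>

lemma smooth_on_fd_along:
  fixes \<phi> :: "'a::euclidean_space \<Rightarrow> 'b::real_normed_vector"
  assumes "open S" "smooth_on S \<phi>" "smooth_on S V"
  shows "smooth_on S (\<lambda>x. fd \<phi> x (V x))"
proof (rule smooth_on_cong[OF assms(1)])
  show "smooth_on S (\<lambda>x. \<Sum>b\<in>Basis. (V x \<bullet> b) *\<^sub>R fd \<phi> x b)"
    unfolding smooth_on_def
  proof
    fix k
    have "Ck_on k S (\<lambda>x. (V x \<bullet> b) *\<^sub>R fd \<phi> x b)" for b
      using smooth_on_scaleR[OF assms(1) smooth_on_inner[OF assms(1,3) smooth_on_const] smooth_on_fd[OF assms(2)]]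
      by (simp add: smooth_on_def)
    then show "Ck_on k S (\<lambda>x. \<Sum>b\<in>Basis. (V x \<bullet> b) *\<^sub>R fd \<phi> x b)"
      by (intro Ck_on_sum assms)
  qed
  show "(\<Sum>b\<in>Basis. (V x \<bullet> b) *\<^sub>R fd \<phi> x b) = fd \<phi> x (V x)" if "x \<in> S" for x
    using linear_euclidean_expand[OF smooth_on_linear_fd[OF assms(2,1) that]] by metis
qed

section \<open>Minkowski space\<close>

text \<open>A timelike normal of the space form inside Minkowski space: constant for the slice, the
  position vector for the hyperboloid. It lets both cases share one proof.\<close>

definition time_axis :: "real \<Rightarrow> minkowski \<Rightarrow> minkowski" where
  "time_axis \<rho> z = (if \<rho> = 0 then (1, 0) else z)"

lemma bounded_bilinear_lorentz: "bounded_bilinear lorentz"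
  unfolding bilinear_conv_bounded_bilinear[symmetric] bilinear_def linear_iff lorentz_def
  by (auto simp: algebra_simps)

interpretation lorentz: bounded_bilinear lorentz by (rule bounded_bilinear_lorentz)

lemmas lorentz_simps = lorentz.add_left lorentz.add_right lorentz.diff_left lorentz.diff_right
  lorentz.minus_left lorentz.minus_right lorentz.scaleR_left lorentz.scaleR_right
  lorentz.zero_left lorentz.zero_right

lemma lorentz_commute: "lorentz v w = lorentz w v"
  by (simp add: lorentz_def inner_commute)

lemma space_form_tangent_iff: "v \<in> space_form_tangent \<rho> z \<longleftrightarrow> lorentz (time_axis \<rho> z) v = 0"
  by (simp add: space_form_tangent_def time_axis_def lorentz_def)

lemma lorentz_time_axis:
  "z \<in> space_form \<rho> \<Longrightarrow> lorentz (time_axis \<rho> z) (time_axis \<rho> z) = (if \<rho> = 0 then - 1 else 1 / \<rho>)"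
  by (auto simp: space_form_def time_axis_def lorentz_def split: if_splits)

lemma time_axis_timelike:
  "\<rho> \<le> 0 \<Longrightarrow> z \<in> space_form \<rho> \<Longrightarrow> lorentz (time_axis \<rho> z) (time_axis \<rho> z) < 0"
  by (simp add: lorentz_time_axis)

text \<open>Orthogonality says that the inner product of the space parts is the product of the time
  parts; Cauchy-Schwarz for the space parts then bounds the time part of \<open>v\<close>. This is
  what makes the induced metrics positive definite although \<open>lorentz\<close> is not.\<close>

lemma orthogonal_timelike_spacelike:
  assumes "lorentz t t < 0" "lorentz t v = 0" "v \<noteq> 0"
  shows "lorentz v v > 0"
proof -
  obtain a A b B where e: "t = (a, A)" "v = (b, B)" by (meson surj_pair)
  have h: "A \<bullet> A < a\<^sup>2" "A \<bullet> B = a * b"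
    using assms by (auto simp: e lorentz_def power2_eq_square)
  have apos: "a\<^sup>2 > 0" using h(1) inner_ge_zero[of A] by linarith
  have "B \<noteq> 0" using h apos assms(3) by (auto simp: e zero_prod_def)
  then have "B \<bullet> B > 0" by simp
  then have "(A \<bullet> A) * (B \<bullet> B) < a\<^sup>2 * (B \<bullet> B)" using h(1) by simp
  moreover have "(a * b)\<^sup>2 \<le> (A \<bullet> A) * (B \<bullet> B)"
    using Cauchy_Schwarz_ineq[of A B] h(2) by simp
  ultimately have "a\<^sup>2 * b\<^sup>2 < a\<^sup>2 * (B \<bullet> B)" by (simp add: power_mult_distrib)
  then have "b\<^sup>2 < B \<bullet> B" using apos by simp
  then show ?thesis by (simp add: e lorentz_def power2_eq_square)
qed

text \<open>Orthogonal vectors that are not null are independent, so four of them span, and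
  \<open>lorentz\<close> is nondegenerate.\<close>

lemma lorentz_orthogonal_basis:
  assumes "finite S" "card S = 4" "\<And>v. v \<in> S \<Longrightarrow> lorentz v v \<noteq> 0"
    "\<And>v w. v \<in> S \<Longrightarrow> w \<in> S \<Longrightarrow> v \<noteq> w \<Longrightarrow> lorentz v w = 0"
    and z: "\<And>v. v \<in> S \<Longrightarrow> lorentz v z = 0"
  shows "z = 0"
proof -
  have "independent S"
  proof (rule ccontr)
    assume "\<not> independent S"
    then obtain u v where uv: "v \<in> S" "u v \<noteq> 0" "(\<Sum>w\<in>S. u w *\<^sub>R w) = 0"
      using dependent_finite[OF assms(1)] by auto
    have "0 = lorentz (\<Sum>w\<in>S. u w *\<^sub>R w) v" by (simp add: uv lorentz_simps)
    also have "\<dots> = (\<Sum>w\<in>S. u w * lorentz w v)" by (simp add: lorentz.sum_left lorentz_simps)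
    also have "\<dots> = (\<Sum>w\<in>S. if w = v then u v * lorentz v v else 0)"
      by (rule sum.cong) (use assms(4) uv(1) in auto)
    also have "\<dots> = u v * lorentz v v" using uv(1) assms(1) by simp
    finally show False using uv assms(3) by simp
  qed
  then have sp: "UNIV \<subseteq> span S"
    using assms(2) by (intro card_ge_dim_independent) auto
  \<comment> \<open>Reversing time turns \<open>lorentz\<close> into the Euclidean inner product,
    for which orthogonality to a spanning set is available.\<close>
  let ?z = "(- fst z, snd z)"
  have j: "v \<bullet> ?z = lorentz v z" for v by (simp add: lorentz_def inner_prod_def)
  have "orthogonal ?z ?z"
    by (rule orthogonal_to_span[of ?z S]) (use sp z in \<open>auto simp: orthogonal_def inner_commute[of ?z] j\<close>)
  then have "?z = 0" by (metis orthogonal_self)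
  then show ?thesis by (simp add: prod_eq_iff)
qed

lemma lorentz_orthogonal_frame:
  assumes "lorentz a a \<noteq> 0" "lorentz b b \<noteq> 0" "lorentz c c \<noteq> 0" "lorentz d d \<noteq> 0"
    and o: "lorentz a b = 0" "lorentz a c = 0" "lorentz a d = 0"
      "lorentz b c = 0" "lorentz b d = 0" "lorentz c d = 0"
    and "lorentz a z = 0" "lorentz b z = 0" "lorentz c z = 0" "lorentz d z = 0"
  shows "z = 0"
proof (rule lorentz_orthogonal_basis[of "{a, b, c, d}"])
  have "a \<noteq> b" "a \<noteq> c" "a \<noteq> d" "b \<noteq> c" "b \<noteq> d" "c \<noteq> d" using assms by auto
  then show "card {a, b, c, d} = 4" by simp
qed (use assms lorentz_commute in \<open>auto, (metis+)?\<close>)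

text \<open>\<open>x\<close> minus its expansion is orthogonal to the whole frame, hence zero. In
  \<open>gauss\<close> this splits a product of second derivatives into ambient, extrinsic and
  tangential parts.\<close>

lemma lorentz_parseval:
  assumes n: "lorentz a a \<noteq> 0" "lorentz b b \<noteq> 0" "lorentz c c \<noteq> 0" "lorentz d d \<noteq> 0"
    and o: "lorentz a b = 0" "lorentz a c = 0" "lorentz a d = 0"
      "lorentz b c = 0" "lorentz b d = 0" "lorentz c d = 0"
  shows "lorentz x y = lorentz a x * lorentz a y / lorentz a a + lorentz b x * lorentz b y / lorentz b b
    + lorentz c x * lorentz c y / lorentz c c + lorentz d x * lorentz d y / lorentz d d"
proof -
  let ?z = "x - ((lorentz a x / lorentz a a) *\<^sub>R a + (lorentz b x / lorentz b b) *\<^sub>R b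
    + (lorentz c x / lorentz c c) *\<^sub>R c + (lorentz d x / lorentz d d) *\<^sub>R d)"
  have o': "lorentz b a = 0" "lorentz c a = 0" "lorentz d a = 0"
      "lorentz c b = 0" "lorentz d b = 0" "lorentz d c = 0"
    using o lorentz_commute by simp_all
  have "?z = 0"
    by (rule lorentz_orthogonal_frame[OF n o]) (simp_all add: lorentz_simps n o o')
  then have "lorentz x y = lorentz ((lorentz a x / lorentz a a) *\<^sub>R a + (lorentz b x / lorentz b b) *\<^sub>R b
    + (lorentz c x / lorentz c c) *\<^sub>R c + (lorentz d x / lorentz d d) *\<^sub>R d) y" by simp
  then show ?thesis by (simp add: lorentz_simps)
qed

text \<open>The ternary vector product: its \<open>lorentz\<close> product with \<open>v\<close> is
  minus the determinant of \<open>v, a, b, c\<close>. It supplies normals from a timelike vector and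
  two tangent vectors.\<close>

definition lorentz_cross :: "minkowski \<Rightarrow> minkowski \<Rightarrow> minkowski \<Rightarrow> minkowski" where
  "lorentz_cross a b c = (snd a \<bullet> cross3 (snd b) (snd c),
     fst a *\<^sub>R cross3 (snd b) (snd c) + fst b *\<^sub>R cross3 (snd c) (snd a) + fst c *\<^sub>R cross3 (snd a) (snd b))"

lemma lorentz_cross_orthogonal:
  "lorentz a (lorentz_cross a b c) = 0" "lorentz b (lorentz_cross a b c) = 0"
  "lorentz c (lorentz_cross a b c) = 0"
  by (simp_all add: lorentz_def lorentz_cross_def cross3_simps)

text \<open>In general the squared length is minus the Gram determinant of \<open>a, b, c\<close>, a
  polynomial identity in coordinates; orthogonality of \<open>a\<close> to \<open>b\<close> and
  \<open>c\<close> factors it.\<close>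

lemma lorentz_cross_norm:
  assumes "lorentz a b = 0" "lorentz a c = 0"
  shows "lorentz (lorentz_cross a b c) (lorentz_cross a b c) =
    - lorentz a a * (lorentz b b * lorentz c c - (lorentz b c)\<^sup>2)"
proof -
  have "lorentz (lorentz_cross a b c) (lorentz_cross a b c) =
    - lorentz a a * (lorentz b b * lorentz c c - (lorentz b c)\<^sup>2)
    + lorentz a b * (lorentz a b * lorentz c c - lorentz b c * lorentz a c)
    - lorentz a c * (lorentz a b * lorentz b c - lorentz b b * lorentz a c)"
    unfolding lorentz_def lorentz_cross_def
    by (simp add: inner_vec_def sum_3 cross_components) algebra
  then show ?thesis using assms by simp
qed

lemma smooth_on_cross3:
  "open S \<Longrightarrow> smooth_on S f \<Longrightarrow> smooth_on S g \<Longrightarrow> smooth_on S (\<lambda>x. cross3 (f x) (g x))"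
  by (rule smooth_on_bilinear[OF _ bilinear_cross[unfolded bilinear_conv_bounded_bilinear]])

lemma smooth_on_lorentz:
  "open S \<Longrightarrow> smooth_on S f \<Longrightarrow> smooth_on S g \<Longrightarrow> smooth_on S (\<lambda>x. lorentz (f x) (g x))"
  by (rule smooth_on_bilinear[OF _ bounded_bilinear_lorentz])

lemma smooth_on_lorentz_cross:
  "open S \<Longrightarrow> smooth_on S f \<Longrightarrow> smooth_on S g \<Longrightarrow> smooth_on S h \<Longrightarrow>
    smooth_on S (\<lambda>x. lorentz_cross (f x) (g x) (h x))"
  unfolding lorentz_cross_def
  by (intro smooth_on_Pair smooth_on_add smooth_on_scaleR smooth_on_inner smooth_on_cross3
      smooth_on_fst smooth_on_snd)

section \<open>Geometry of a patch\<close>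

abbreviation e1 :: "real^2" where "e1 \<equiv> axis 1 1"
abbreviation e2 :: "real^2" where "e2 \<equiv> axis 2 1"

lemma vec2_expand: "(v::real^2) = v$1 *\<^sub>R e1 + v$2 *\<^sub>R e2"
  by (simp add: vec_eq_iff forall_2 axis_def)

lemma linear_vec2: "linear (L :: real^2 \<Rightarrow> 'b::real_vector) \<Longrightarrow> L v = v$1 *\<^sub>R L e1 + v$2 *\<^sub>R L e2"
  using arg_cong[OF vec2_expand[of v], of L] by (simp only: linear_add linear_scale)

lemma nontrivial_vec2: "a \<noteq> 0 \<or> b \<noteq> 0 \<Longrightarrow> a *\<^sub>R e1 + b *\<^sub>R e2 \<noteq> 0"
  by (auto simp: vec_eq_iff forall_2 axis_def)

locale immersed_patch =
  fixes \<rho> :: real and D :: "(real^2) set" and f :: "real^2 \<Rightarrow> minkowski"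
  assumes curvature_nonpos: "\<rho> \<le> 0"
    and open_domain: "open D"
    and smooth_f: "smooth_on D f"
    and f_in: "\<And>x. x \<in> D \<Longrightarrow> f x \<in> space_form \<rho>"
    and inj_f: "\<And>x. x \<in> D \<Longrightarrow> inj (fd f x)"
begin

definition t where "t x = time_axis \<rho> (f x)"

text \<open>Records whether the timelike normal \<open>t\<close> moves with the surface:
  \<open>dt = \<kappa> df\<close>. Since \<open>\<kappa>^2 / lorentz t t = \<rho>\<close> in both
  cases, the ambient curvature enters the Gauss equation through this constant.\<close>

definition \<kappa> :: real where "\<kappa> = (if \<rho> = 0 then 0 else 1)"

abbreviation g where "g \<equiv> induced_metric f"

lemma linear_f: "x \<in> D \<Longrightarrow> linear (fd f x)"
  using smooth_on_linear_fd[OF smooth_f open_domain] .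

lemma deriv_lorentz:
  assumes "smooth_on D a" "smooth_on D b" "x \<in> D"
  shows "fd (\<lambda>x. lorentz (a x) (b x)) x v = lorentz (fd a x v) (b x) + lorentz (a x) (fd b x v)"
  using fd_eqI[OF lorentz.FDERIV[OF smooth_on_has_derivative[OF assms(1) open_domain assms(3)]
      smooth_on_has_derivative[OF assms(2) open_domain assms(3)]]] by simp

lemma deriv_mult:
  assumes "smooth_on D a" "smooth_on D b" "x \<in> D"
  shows "fd (\<lambda>x. a x * b x :: real) x v = fd a x v * b x + a x * fd b x v"
  using fd_eqI[OF has_derivative_mult[OF smooth_on_has_derivative[OF assms(1) open_domain assms(3)]
      smooth_on_has_derivative[OF assms(2) open_domain assms(3)]]] by simp

lemma deriv_scaleR:
  assumes "smooth_on D a" "smooth_on D b" "x \<in> D"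
  shows "fd (\<lambda>x. a x *\<^sub>R b x) x v = fd a x v *\<^sub>R b x + a x *\<^sub>R fd b x v"
  using fd_eqI[OF has_derivative_scaleR[OF smooth_on_has_derivative[OF assms(1) open_domain assms(3)]
      smooth_on_has_derivative[OF assms(2) open_domain assms(3)]]] by simp

lemma deriv_const_on:
  assumes "x \<in> D" "\<And>y. y \<in> D \<Longrightarrow> a y = c"
  shows "fd a x v = 0"
  using fd_cong[OF open_domain assms(1), of a "\<lambda>_. c"] assms(2) by simp

lemma lorentz_deriv_zero:
  assumes "smooth_on D a" "smooth_on D b" "\<And>y. y \<in> D \<Longrightarrow> lorentz (a y) (b y) = c" "x \<in> D"
  shows "lorentz (fd a x v) (b x) + lorentz (a x) (fd b x v) = 0"
  using deriv_lorentz[OF assms(1,2,4)] deriv_const_on[OF assms(4), of "\<lambda>x. lorentz (a x) (b x)"] assms(3)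
  by metis

lemma smooth_t: "smooth_on D t"
  unfolding t_def time_axis_def using smooth_f smooth_on_const by (cases "\<rho> = 0") auto

lemma fd_t: "x \<in> D \<Longrightarrow> fd t x v = \<kappa> *\<^sub>R fd f x v"
  unfolding t_def time_axis_def \<kappa>_def by (cases "\<rho> = 0") auto

lemma t_timelike: "x \<in> D \<Longrightarrow> lorentz (t x) (t x) < 0"
  unfolding t_def using time_axis_timelike curvature_nonpos f_in by blast

lemma \<kappa>_t: "x \<in> D \<Longrightarrow> \<kappa> * \<kappa> / lorentz (t x) (t x) = \<rho>"
  unfolding t_def using lorentz_time_axis[OF f_in] by (simp add: \<kappa>_def)

text \<open>Differentiate the equation of the space form: \<open>lorentz t f = 0\<close> for the
  slice, with \<open>t\<close> constant, and \<open>lorentz f f = 1 / \<rho>\<close> for the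
  hyperboloid.\<close>

lemma t_orth_f: assumes "x \<in> D" shows "lorentz (t x) (fd f x v) = 0"
proof (cases "\<rho> = 0")
  case True
  then have "lorentz (t y) (f y) = 0" if "y \<in> D" for y
    using f_in[OF that] unfolding t_def time_axis_def by (simp add: lorentz_def space_form_def)
  from lorentz_deriv_zero[OF smooth_t smooth_f this assms, of v]
  have "lorentz (\<kappa> *\<^sub>R fd f x v) (f x) + lorentz (t x) (fd f x v) = 0"
    by (simp only: fd_t[OF assms])
  moreover have "\<kappa> = 0" unfolding \<kappa>_def using True by simp
  ultimately show ?thesis by (simp only: scaleR_zero_left lorentz.zero_left add_0)
next
  case False
  then have "lorentz (f y) (f y) = 1 / \<rho>" if "y \<in> D" for y
    using f_in[OF that] by (simp add: space_form_def)
  from lorentz_deriv_zero[OF smooth_f smooth_f this assms] show ?thesis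
    using False lorentz_commute[of "f x"] by (simp add: t_def time_axis_def)
qed

text \<open>The image of \<open>v\<close> is nonzero by the immersion property and orthogonal to the
  timelike \<open>t\<close>, so it is spacelike.\<close>

lemma metric_pos: "x \<in> D \<Longrightarrow> v \<noteq> 0 \<Longrightarrow> g x v v > 0"
  unfolding induced_metric_def
  using orthogonal_timelike_spacelike[OF t_timelike t_orth_f] inj_f linear_f
  by (metis injD linear_0)

lemma metric_commute: "g x v w = g x w v"
  unfolding induced_metric_def using lorentz_commute by blast

lemma linear_metric: "x \<in> D \<Longrightarrow> linear (g x v)"
  unfolding induced_metric_def using linear_f[of x]
  by (auto simp: linear_iff lorentz_simps)

lemma metric_bilinear: 
  assumes "x \<in> D"
  shows "g x (a + b) v = g x a v + g x b v" "g x v (a + b) = g x v a + g x v b"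
   "g x (r *\<^sub>R a) v = r * g x a v" "g x v (r *\<^sub>R a) = r * g x v a"
   "g x (a - b) v = g x a v - g x b v" "g x v (a - b) = g x v a - g x v b"
  using linear_metric[OF assms] metric_commute[of x]
  by (auto simp: linear_add linear_scale linear_diff)

lemma metric_zero: "x \<in> D \<Longrightarrow> g x 0 v = 0" "x \<in> D \<Longrightarrow> g x v 0 = 0"
  using linear_0[OF linear_metric[of x v]] metric_commute[of x] by simp_all

lemma smooth_metric: "smooth_on D V \<Longrightarrow> smooth_on D W \<Longrightarrow> smooth_on D (\<lambda>x. g x (V x) (W x))"
  unfolding induced_metric_def
  by (intro smooth_on_lorentz smooth_on_fd_along open_domain smooth_f)

lemma metric_ext:
  assumes "x \<in> D" "\<And>v. g x a v = g x b v" shows "a = b"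
proof -
  have "g x (a - b) (a - b) = 0" using metric_bilinear[OF assms(1)] assms(2) by simp
  then show ?thesis using metric_pos[OF assms(1), of "a - b"] by force
qed

lemma metric_cauchy_schwarz:
  assumes "x \<in> D" shows "(g x v w)\<^sup>2 \<le> g x v v * g x w w"
proof (cases "w = 0")
  case True then show ?thesis using linear_metric[OF assms] by (simp add: linear_0)
next
  case False
  note p = metric_pos[OF assms False]
  let ?u = "v - (g x v w / g x w w) *\<^sub>R w"
  have "0 \<le> g x ?u ?u" using metric_pos[OF assms, of ?u] linear_metric[OF assms]
    by (cases "?u = 0") (auto simp: linear_0)
  also have "g x ?u ?u = g x v v - (g x v w)\<^sup>2 / g x w w"
    using p by (simp add: metric_bilinear[OF assms] metric_commute[of x w v] field_simps power2_eq_square)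
  finally show ?thesis using p by (simp add: field_simps)
qed

section \<open>Metric duals and gradients\<close>

definition gram where "gram x = g x e1 e1 * g x e2 e2 - (g x e1 e2)\<^sup>2"

lemma gram_pos: assumes "x \<in> D" shows "gram x > 0"
proof -
  \<comment> \<open>The part of \<open>e1\<close> orthogonal to \<open>e2\<close>, scaled by
    \<open>g x e2 e2\<close> to avoid a division.\<close>
  let ?v = "g x e2 e2 *\<^sub>R e1 + (- g x e1 e2) *\<^sub>R e2"
  have p: "g x e2 e2 > 0" by (rule metric_pos[OF assms]) (simp add: axis_eq_0_iff)
  then have "g x ?v ?v > 0" by (intro metric_pos[OF assms] nontrivial_vec2) auto
  also have "g x ?v ?v = g x e2 e2 * gram x"
    by (simp only: metric_bilinear[OF assms] metric_commute[of x e2 e1] gram_def)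
      (simp add: algebra_simps power2_eq_square)
  finally show ?thesis using p by (simp add: zero_less_mult_iff)
qed

text \<open>The metric dual of the functional with values \<open>l1, l2\<close> at
  \<open>e1, e2\<close>, by Cramer's rule. Unlike the descriptions with \<open>THE\<close>, this
  formula shows smooth dependence on the point.\<close>

definition sharp :: "real^2 \<Rightarrow> real \<Rightarrow> real \<Rightarrow> real^2" where
  "sharp x l1 l2 = ((g x e2 e2 * l1 - g x e1 e2 * l2) / gram x) *\<^sub>R e1
    + ((g x e1 e1 * l2 - g x e1 e2 * l1) / gram x) *\<^sub>R e2"

lemma metric_sharp:
  assumes "x \<in> D" "linear l" shows "g x (sharp x (l e1) (l e2)) v = l v"
proof -
  have p: "gram x \<noteq> 0" using gram_pos[OF assms(1)] by simp
  have "g x (sharp x (l e1) (l e2)) e1 = ((g x e2 e2 * l e1 - g x e1 e2 * l e2) * g x e1 e1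
      + (g x e1 e1 * l e2 - g x e1 e2 * l e1) * g x e1 e2) / gram x"
    unfolding sharp_def metric_bilinear[OF assms(1)] metric_commute[of x e2 e1]
    by (simp add: add_divide_distrib)
  also have "\<dots> = l e1 * gram x / gram x"
    unfolding gram_def by (rule arg_cong[of _ _ "\<lambda>a. a / _"]) (simp add: algebra_simps power2_eq_square)
  finally have a1: "g x (sharp x (l e1) (l e2)) e1 = l e1" using p by simp
  have "g x (sharp x (l e1) (l e2)) e2 = ((g x e2 e2 * l e1 - g x e1 e2 * l e2) * g x e1 e2
      + (g x e1 e1 * l e2 - g x e1 e2 * l e1) * g x e2 e2) / gram x"
    unfolding sharp_def metric_bilinear[OF assms(1)]
    by (simp add: add_divide_distrib)
  also have "\<dots> = l e2 * gram x / gram x"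
    unfolding gram_def by (rule arg_cong[of _ _ "\<lambda>a. a / _"]) (simp add: algebra_simps power2_eq_square)
  finally have a2: "g x (sharp x (l e1) (l e2)) e2 = l e2" using p by simp
  have "g x (sharp x (l e1) (l e2)) v = v$1 *\<^sub>R g x (sharp x (l e1) (l e2)) e1 + v$2 *\<^sub>R g x (sharp x (l e1) (l e2)) e2"
    by (rule linear_vec2[OF linear_metric[OF assms(1)]])
  also have "\<dots> = l v" unfolding a1 a2 by (rule linear_vec2[OF assms(2), symmetric])
  finally show ?thesis .
qed

lemma sharp_unique:
  assumes "x \<in> D" "linear l" "\<And>v. g x w v = l v"
  shows "w = sharp x (l e1) (l e2)"
  by (rule metric_ext[OF assms(1)]) (simp add: metric_sharp[OF assms(1,2)] assms(3))

lemma smooth_sharp: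
  "smooth_on D a \<Longrightarrow> smooth_on D b \<Longrightarrow> smooth_on D (\<lambda>x. sharp x (a x) (b x))"
  unfolding sharp_def using gram_pos unfolding gram_def power2_eq_square
  by (intro smooth_on_add smooth_on_scaleR smooth_on_divide smooth_on_diff smooth_on_mult
      smooth_on_const smooth_metric open_domain) auto

lemma surface_grad_eq:
  assumes "x \<in> D" "linear (fd h x)"
  shows "surface_grad f h x = sharp x (fd h x e1) (fd h x e2)"
  unfolding surface_grad_def
  using metric_sharp[OF assms] sharp_unique[OF assms] by (intro the_equality) auto

lemma metric_surface_grad:
  assumes "x \<in> D" "linear (fd h x)" shows "g x (surface_grad f h x) v = fd h x v"
  using surface_grad_eq[OF assms] metric_sharp[OF assms] by simp

lemma smooth_surface_grad:
  assumes "smooth_on D h" shows "smooth_on D (surface_grad f h)"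
proof (rule smooth_on_cong[OF open_domain])
  show "smooth_on D (\<lambda>x. sharp x (fd h x e1) (fd h x e2))"
    by (intro smooth_sharp smooth_on_fd assms)
  show "sharp x (fd h x e1) (fd h x e2) = surface_grad f h x" if "x \<in> D" for x
    using surface_grad_eq[OF that smooth_on_linear_fd[OF assms open_domain that]] by simp
qed

end

section \<open>The shape operator\<close>

locale oriented_patch = immersed_patch +
  fixes \<nu> :: "real^2 \<Rightarrow> minkowski"
  assumes smooth_\<nu>: "smooth_on D \<nu>"
    and \<nu>_tangent: "\<And>x. x \<in> D \<Longrightarrow> \<nu> x \<in> space_form_tangent \<rho> (f x)"
    and \<nu>_unit: "\<And>x. x \<in> D \<Longrightarrow> lorentz (\<nu> x) (\<nu> x) = 1"
    and \<nu>_orth: "\<And>x v. x \<in> D \<Longrightarrow> lorentz (\<nu> x) (fd f x v) = 0"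
begin

abbreviation S where "S \<equiv> shape_operator \<rho> f \<nu>"
abbreviation H where "H \<equiv> mean_curvature \<rho> f \<nu>"

lemma \<nu>_orth_t: "x \<in> D \<Longrightarrow> lorentz (\<nu> x) (t x) = 0"
  using \<nu>_tangent by (simp add: space_form_tangent_iff t_def lorentz_commute)

lemma fd_\<nu>_orth_\<nu>: "x \<in> D \<Longrightarrow> lorentz (fd \<nu> x v) (\<nu> x) = 0"
  using lorentz_deriv_zero[OF smooth_\<nu> smooth_\<nu> \<nu>_unit, of x v] lorentz_commute[of "\<nu> x"] by simp

lemma fd_\<nu>_orth_t: "x \<in> D \<Longrightarrow> lorentz (fd \<nu> x v) (t x) = 0"
  using lorentz_deriv_zero[OF smooth_\<nu> smooth_t \<nu>_orth_t, of x v]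
  by (simp add: fd_t lorentz_simps \<nu>_orth)

lemma fd_\<nu>_metric: "x \<in> D \<Longrightarrow> lorentz (fd \<nu> x v) (fd f x u) = - lorentz (\<nu> x) (fd (\<lambda>y. fd f y u) x v)"
  using lorentz_deriv_zero[OF smooth_\<nu> smooth_on_fd[OF smooth_f] \<nu>_orth, of x v u] by simp

lemma linear_\<nu>: "x \<in> D \<Longrightarrow> linear (fd \<nu> x)"
  using smooth_on_linear_fd[OF smooth_\<nu> open_domain] .

text \<open>The tangential projection changes nothing: \<open>\<nu>\<close> is orthogonal to
  \<open>t\<close> and to \<open>dt = \<kappa> df\<close>, so its flat derivative is already
  orthogonal to \<open>t\<close>.\<close>

lemma cov_deriv_\<nu>: "x \<in> D \<Longrightarrow> cov_deriv \<rho> f \<nu> x v = fd \<nu> x v"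
  using fd_\<nu>_orth_t[of x v] by (auto simp: cov_deriv_def Let_def t_def time_axis_def lorentz_commute)

text \<open>The witness is the metric dual of \<open>v \<mapsto> lorentz y (df v)\<close>. What
  remains of \<open>y\<close> is orthogonal to the tangent plane, to \<open>t\<close> and to
  \<open>\<nu>\<close>, which together span four dimensions.\<close>

lemma tangent_in_range:
  assumes x: "x \<in> D" and y: "lorentz y (\<nu> x) = 0" "lorentz y (t x) = 0"
  shows "\<exists>w. fd f x w = y"
proof -
  let ?l = "\<lambda>v. lorentz y (fd f x v)"
  have l: "linear ?l" using linear_f[OF x] by (auto simp: linear_iff lorentz_simps)
  let ?w = "sharp x (?l e1) (?l e2)"
  let ?z = "y - fd f x ?w"
  \<comment> \<open>Gram-Schmidt applied to \<open>e2\<close>, to obtain an orthogonal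
    frame.\<close>
  let ?b = "fd f x (e2 - (g x e1 e2 / g x e1 e1) *\<^sub>R e1)"
  have zf: "lorentz (fd f x v) ?z = 0" for v
    using metric_sharp[OF x l, of v] lorentz_commute[of _ "fd f x v"]
    by (simp add: induced_metric_def lorentz_simps)
  have p: "g x e1 e1 > 0" by (rule metric_pos[OF x]) (simp add: axis_eq_0_iff)
  have q: "g x (e2 - (g x e1 e2 / g x e1 e1) *\<^sub>R e1) (e2 - (g x e1 e2 / g x e1 e1) *\<^sub>R e1) > 0"
    using nontrivial_vec2[of "- (g x e1 e2 / g x e1 e1)" 1] by (intro metric_pos[OF x]) simp
  have r: "g x e1 (e2 - (g x e1 e2 / g x e1 e1) *\<^sub>R e1) = 0"
    using p by (simp add: metric_bilinear[OF x])
  have "?z = 0"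
  proof (rule lorentz_orthogonal_frame[of "t x" "\<nu> x" "fd f x e1" ?b])
    show "lorentz (t x) (t x) \<noteq> 0" using t_timelike[OF x] by simp
    show "lorentz (\<nu> x) (\<nu> x) \<noteq> 0" using \<nu>_unit[OF x] by simp
    show "lorentz (fd f x e1) (fd f x e1) \<noteq> 0" using p by (simp add: induced_metric_def)
    show "lorentz ?b ?b \<noteq> 0" using q by (simp add: induced_metric_def)
    show "lorentz (fd f x e1) ?b = 0" using r by (simp add: induced_metric_def)
    show "lorentz (t x) ?z = 0" "lorentz (\<nu> x) ?z = 0"
      using y t_orth_f[OF x] \<nu>_orth[OF x] by (simp_all add: lorentz_simps lorentz_commute[of _ y])
  qed (use t_orth_f[OF x] \<nu>_orth[OF x] \<nu>_orth_t[OF x] zf in \<open>simp_all add: lorentz_commute[of "t x" "\<nu> x"]\<close>)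
  then show ?thesis by (metis eq_iff_diff_eq_0)
qed

text \<open>Evaluates the \<open>THE\<close>: existence because the derivative of
  \<open>\<nu>\<close> is tangent, uniqueness because \<open>df\<close> is injective.\<close>

lemma fd_f_shape: assumes "x \<in> D" shows "fd f x (S x v) = - fd \<nu> x v"
proof -
  obtain w where w: "fd f x w = - fd \<nu> x v"
    using tangent_in_range[OF assms, of "- fd \<nu> x v"] fd_\<nu>_orth_t[OF assms] fd_\<nu>_orth_\<nu>[OF assms]
    by (auto simp: lorentz_simps)
  have "S x v = w" unfolding shape_operator_def cov_deriv_\<nu>[OF assms]
    using w inj_f[OF assms] by (intro the_equality) (metis, metis injD)
  then show ?thesis using w by simp
qed

lemma linear_shape: assumes "x \<in> D" shows "linear (S x)"
proof -
  have 1: "a = b" if "fd f x a = fd f x b" for a b using inj_f[OF assms] that by (simp add: inj_eq)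
  show ?thesis
    using linear_f[OF assms] linear_\<nu>[OF assms] fd_f_shape[OF assms]
    by (auto simp: linear_iff intro!: 1)
qed

text \<open>The second fundamental form read off from the second derivatives of \<open>f\<close>.
  Self-adjointness of the shape operator and smoothness of \<open>H\<close> both rest on it.\<close>

lemma metric_shape: "x \<in> D \<Longrightarrow> g x (S x v) u = lorentz (\<nu> x) (fd (\<lambda>y. fd f y u) x v)"
  unfolding induced_metric_def by (simp add: fd_f_shape lorentz_simps fd_\<nu>_metric)

lemma shape_self_adjoint: "x \<in> D \<Longrightarrow> g x (S x v) u = g x v (S x u)"
  using metric_shape second_derivative_symmetric[OF smooth_f open_domain, of x v u] metric_commute by metis

lemma shape_sharp:
  assumes "x \<in> D" shows "S x v = sharp x (lorentz (\<nu> x) (fd (\<lambda>y. fd f y e1) x v))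
    (lorentz (\<nu> x) (fd (\<lambda>y. fd f y e2) x v))"
  using sharp_unique[OF assms linear_metric[OF assms], of "S x v" "S x v"] metric_shape[OF assms] by simp

lemma mean_curvature_nth: "x \<in> D \<Longrightarrow> H x = (S x e1 $ 1 + S x e2 $ 2) / 2"
  by (simp add: mean_curvature_def trace_def sum_2 matrix_def)

lemma smooth_H: "smooth_on D H"
proof (rule smooth_on_cong[OF open_domain])
  show "smooth_on D (\<lambda>x. (1/2) * (sharp x (lorentz (\<nu> x) (fd (\<lambda>y. fd f y e1) x e1)) (lorentz (\<nu> x) (fd (\<lambda>y. fd f y e2) x e1)) $ 1
    + sharp x (lorentz (\<nu> x) (fd (\<lambda>y. fd f y e1) x e2)) (lorentz (\<nu> x) (fd (\<lambda>y. fd f y e2) x e2)) $ 2))"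
    by (intro smooth_on_mult smooth_on_const smooth_on_add smooth_on_nth smooth_sharp smooth_on_lorentz
        smooth_\<nu> smooth_on_fd smooth_f open_domain)
qed (simp add: mean_curvature_nth shape_sharp)

end

text \<open>To be used with \<open>h = H\<^sup>2\<close> and \<open>e = |grad h|\<^sup>2\<close>. For \<open>r = H\<^sup>-\<^sup>3\<^sup>/\<^sup>4\<close>, which is
  proportional to the length of the level curves of \<open>H\<close>, it is \<open>r'\<^sup>2 + 9 r\<^sup>-\<^sup>2\<^sup>/\<^sup>3 + \<rho> r\<^sup>2\<close>.\<close>

definition first_integral :: "real \<Rightarrow> real \<Rightarrow> real \<Rightarrow> real" where
  "first_integral \<rho> h e = 9/64 * e * h powr (-11/4) + 9 * h powr (1/4) + \<rho> * h powr (-3/4)"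

definition grad_norm2 :: "(real^2 \<Rightarrow> minkowski) \<Rightarrow> (real^2 \<Rightarrow> real) \<Rightarrow> real^2 \<Rightarrow> real" where
  "grad_norm2 f h x = induced_metric f x (surface_grad f h x) (surface_grad f h x)"

section \<open>Codazzi and Gauss on a biconservative patch\<close>

locale biconservative_patch = oriented_patch +
  assumes biconservative: "\<And>x. x \<in> D \<Longrightarrow> biconservative_at \<rho> f \<nu> x"
begin

definition G where "G = surface_grad f H"
text \<open>A coordinate rotation of \<open>dH\<close>, tangent to the level curves of
  \<open>H\<close>. It is not a unit field; in exchange it is smooth everywhere and just vanishes at
  critical points.\<close>

definition N where "N x = fd H x e1 *\<^sub>R e2 - fd H x e2 *\<^sub>R e1"
text \<open>This is \<open>|grad H|^2\<close>, in the form in which the bracket identity for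
  \<open>H\<close> produces it.\<close>

definition E where "E x = fd H x (G x)"
definition Gf where "Gf x = fd f x (G x)"
definition Nf where "Nf x = fd f x (N x)"

lemma linear_H: "x \<in> D \<Longrightarrow> linear (fd H x)"
  using smooth_on_linear_fd[OF smooth_H open_domain] .

lemma smooth_G: "smooth_on D G"
  unfolding G_def by (rule smooth_surface_grad[OF smooth_H])

lemma smooth_N: "smooth_on D N"
  unfolding N_def by (intro smooth_on_diff smooth_on_scaleR smooth_on_fd smooth_on_const smooth_H open_domain)

lemma smooth_E: "smooth_on D E"
  unfolding E_def by (intro smooth_on_fd_along smooth_H smooth_G open_domain)

lemma smooth_Gf: "smooth_on D Gf"
  unfolding Gf_def by (intro smooth_on_fd_along smooth_f smooth_G open_domain)

lemma smooth_Nf: "smooth_on D Nf"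
  unfolding Nf_def by (intro smooth_on_fd_along smooth_f smooth_N open_domain)

lemma metric_G: "x \<in> D \<Longrightarrow> g x (G x) v = fd H x v"
  unfolding G_def using metric_surface_grad linear_H by blast

lemma deriv_H_N: "x \<in> D \<Longrightarrow> fd H x (N x) = 0"
  unfolding N_def using linear_H[of x] by (simp add: linear_diff linear_scale)

lemma E_eq: "x \<in> D \<Longrightarrow> E x = g x (G x) (G x)"
  by (simp add: E_def metric_G)

lemma critical:
  assumes "x \<in> D" "E x = 0"
  shows "G x = 0" "fd H x v = 0" "N x = 0"
proof -
  show 0: "G x = 0" using metric_pos[OF assms(1), of "G x"] assms by (auto simp: E_eq)
  have "fd H x v = 0" for v
    using metric_G[OF assms(1), of v] by (simp add: 0 metric_zero[OF assms(1)])
  then show "fd H x v = 0" "N x = 0" by (simp_all add: N_def)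
qed

lemma shape_G: "x \<in> D \<Longrightarrow> S x (G x) = - H x *\<^sub>R G x"
proof -
  assume "x \<in> D"
  then have "2 *\<^sub>R (S x (G x) + H x *\<^sub>R G x) = 0"
    using biconservative[of x] unfolding biconservative_at_def Let_def G_def by (simp add: scaleR_add_right)
  then have "S x (G x) + H x *\<^sub>R G x = 0" by simp
  then show ?thesis by (simp add: eq_neg_iff_add_eq_0)
qed

lemma deriv_H_shape: "x \<in> D \<Longrightarrow> fd H x (S x v) = - H x * fd H x v"
  by (metis metric_G metric_bilinear(3) shape_G shape_self_adjoint)

text \<open>\<open>dH\<close> is a left eigenvector of \<open>S\<close> for \<open>- H\<close> and
  the trace is \<open>2 H\<close>, so \<open>S\<close> multiplies the kernel of \<open>dH\<close> by
  \<open>3 H\<close>. As polynomial identities in coordinates this needs no separate treatment of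
  critical points.\<close>

lemma shape_N: assumes "x \<in> D" shows "S x (N x) = (3 * H x) *\<^sub>R N x"
proof -
  define h1 h2 where h: "h1 = fd H x e1" "h2 = fd H x e2"
  have dH: "fd H x v = v$1 * h1 + v$2 * h2" for v
    using linear_vec2[OF linear_H[OF assms], of v] by (simp add: h)
  have a: "S x e1 $ 1 * h1 + S x e1 $ 2 * h2 = - H x * h1"
    "S x e2 $ 1 * h1 + S x e2 $ 2 * h2 = - H x * h2"
    using deriv_H_shape[OF assms, of e1] deriv_H_shape[OF assms, of e2] by (simp_all only: dH[of "S x _"] h)
  have b: "S x e1 $ 1 + S x e2 $ 2 = 2 * H x" using mean_curvature_nth[OF assms] by simp
  have c: "S x (N x) = h1 *\<^sub>R S x e2 - h2 *\<^sub>R S x e1"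
    unfolding N_def h using linear_shape[OF assms] by (simp add: linear_diff linear_scale)
  have d: "N x = h1 *\<^sub>R e2 - h2 *\<^sub>R e1" by (simp add: N_def h)
  have "h1 * (S x e2 $ 1) - h2 * (S x e1 $ 1) = - (3 * H x * h2)" using a b by algebra
  moreover have "h1 * (S x e2 $ 2) - h2 * (S x e1 $ 2) = 3 * H x * h1" using a b by algebra
  ultimately show ?thesis unfolding c by (simp add: d vec_eq_iff forall_2 axis_def)
qed

lemma deriv_\<nu>_G: "x \<in> D \<Longrightarrow> fd \<nu> x (G x) = H x *\<^sub>R Gf x"
  using fd_f_shape[of x "G x"] linear_f[of x] by (simp add: shape_G Gf_def linear_neg linear_scale)

lemma deriv_\<nu>_N: "x \<in> D \<Longrightarrow> fd \<nu> x (N x) = (- 3 * H x) *\<^sub>R Nf x"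
  using fd_f_shape[of x "N x"] linear_f[of x]
  by (simp add: shape_N Nf_def linear_scale neg_equal_iff_equal[symmetric, of "fd \<nu> x (N x)"])

lemma Gf_Gf: "x \<in> D \<Longrightarrow> lorentz (Gf x) (Gf x) = E x"
  by (simp add: E_eq Gf_def induced_metric_def)

lemma Gf_Nf: "x \<in> D \<Longrightarrow> lorentz (Gf x) (Nf x) = 0"
  using metric_G[of x "N x"] by (simp add: deriv_H_N Gf_def Nf_def induced_metric_def)

text \<open>Applying \<open>dH\<close> forces the coefficient of \<open>G\<close>, as
  \<open>dH\<close> is \<open>E\<close> on \<open>G\<close> and 0 on \<open>N\<close>; the remainder
  lies in the kernel of \<open>dH\<close>, a line spanned by \<open>N\<close>.\<close>

lemma frame_coordinates:
  assumes "x \<in> D" "E x \<noteq> 0" obtains b where "v = (fd H x v / E x) *\<^sub>R G x + b *\<^sub>R N x"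
proof -
  define h1 h2 where h: "h1 = fd H x e1" "h2 = fd H x e2"
  have dH: "fd H x v = v$1 * h1 + v$2 * h2" for v
    using linear_vec2[OF linear_H[OF assms(1)], of v] by (simp add: h)
  have d: "N x = h1 *\<^sub>R e2 - h2 *\<^sub>R e1" by (simp add: N_def h)
  define w where "w = v - (fd H x v / E x) *\<^sub>R G x"
  have "fd H x w = 0"
    using linear_H[OF assms(1)] assms(2) by (simp add: w_def linear_diff linear_scale E_def)
  then have w0: "w$1 * h1 + w$2 * h2 = 0" by (simp add: dH)
  have "h1\<^sup>2 + h2\<^sup>2 \<noteq> 0"
    using assms(2) dH[of "G x"] by (auto simp: E_def sum_power2_eq_zero_iff)
  \<comment> \<open>\<open>N\<close> has coordinates \<open>(- h2, h1)\<close>; the coefficient is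
    that of the Euclidean projection to \<open>N\<close>.\<close>
  then have "w = ((w$2 * h1 - w$1 * h2) / (h1\<^sup>2 + h2\<^sup>2)) *\<^sub>R N x"
    unfolding d vec_eq_iff forall_2 using w0
    by (simp add: axis_def field_simps) algebra
  then show thesis using that[of "(w$2 * h1 - w$1 * h2) / (h1\<^sup>2 + h2\<^sup>2)"] by (simp add: w_def algebra_simps)
qed

lemma Nf_pos:
  assumes "x \<in> D" "E x \<noteq> 0" shows "lorentz (Nf x) (Nf x) > 0"
proof -
  have "N x \<noteq> 0"
  proof
    assume "N x = 0"
    then have "fd H x e1 = 0 \<and> fd H x e2 = 0" by (simp add: N_def vec_eq_iff forall_2 axis_def)
    then have "fd H x (G x) = 0" using linear_vec2[OF linear_H[OF assms(1)], of "G x"] by simp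
    then show False using assms(2) by (simp add: E_def)
  qed
  then show ?thesis using metric_pos[OF assms(1)] by (simp add: Nf_def induced_metric_def)
qed

lemma deriv_E: "x \<in> D \<Longrightarrow> fd E x v = 2 * lorentz (fd Gf x v) (Gf x)"
  using deriv_lorentz[OF smooth_Gf smooth_Gf, of x v] fd_cong[OF open_domain, of x "\<lambda>x. lorentz (Gf x) (Gf x)" E] Gf_Gf
  by (simp add: lorentz_commute[of "Gf x"])

text \<open>The Codazzi equation: the bracket \<open>[G, N]\<close> is applied to \<open>H\<close>, \<open>f\<close> and \<open>\<nu>\<close>.\<close>

lemma codazzi:
  assumes x: "x \<in> D" "E x \<noteq> 0"
  obtains b where "fd N x (G x) - fd G x (N x) = b *\<^sub>R N x" "fd E x (N x) = 0"
    "(4 * H x) *\<^sub>R fd Gf x (N x) = (- 3 * E x) *\<^sub>R Nf x"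
    "fd Nf x (G x) = fd Gf x (N x) + b *\<^sub>R Nf x" "H x \<noteq> 0"
proof -
  let ?c = "fd N x (G x) - fd G x (N x)"
  define a where "a = fd H x ?c / E x"
  obtain b where b: "?c = a *\<^sub>R G x + b *\<^sub>R N x"
    using frame_coordinates[OF x, of ?c] unfolding a_def by metis
  \<comment> \<open>Bracket on \<open>H\<close>: since \<open>dH\<close> vanishes on
    \<open>N\<close> throughout, only the derivative of \<open>E\<close> along \<open>N\<close>
    survives, and it measures \<open>a\<close>.\<close>
  have "fd (\<lambda>y. fd H y (N y)) x (G x) - fd E x (N x) = fd H x ?c"
    using bracket_commutator[OF smooth_H smooth_G smooth_N open_domain x(1)] by (simp add: E_def[abs_def])
  then have EN: "fd E x (N x) = - a * E x"
    using deriv_const_on[OF x(1) deriv_H_N] x(2) by (simp add: a_def)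
  have "fd Nf x (G x) - fd Gf x (N x) = fd f x ?c"
    using bracket_commutator[OF smooth_f smooth_G smooth_N open_domain x(1)]
    by (simp add: Gf_def[abs_def] Nf_def[abs_def])
  then have 1: "fd Nf x (G x) = fd Gf x (N x) + (a *\<^sub>R Gf x + b *\<^sub>R Nf x)"
    using linear_f[OF x(1)] unfolding b by (simp add: linear_add linear_scale Gf_def Nf_def algebra_simps)
  \<comment> \<open>Bracket on \<open>\<nu>\<close>, whose derivatives along \<open>G\<close> and
    \<open>N\<close> are known multiples of \<open>Gf\<close> and \<open>Nf\<close>. With
    \<open>1\<close>, this becomes a linear equation for \<open>fd Gf x (N x)\<close>.\<close>
  have "fd (\<lambda>y. fd \<nu> y (N y)) x (G x) - fd (\<lambda>y. fd \<nu> y (G y)) x (N x) = fd \<nu> x ?c"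
    using bracket_commutator[OF smooth_\<nu> smooth_G smooth_N open_domain x(1)] .
  moreover have "fd (\<lambda>y. fd \<nu> y (N y)) x = fd (\<lambda>y. (- 3 * H y) *\<^sub>R Nf y) x"
    by (rule fd_cong[OF open_domain x(1)]) (rule deriv_\<nu>_N)
  moreover have "fd (\<lambda>y. fd \<nu> y (G y)) x = fd (\<lambda>y. H y *\<^sub>R Gf y) x"
    by (rule fd_cong[OF open_domain x(1)]) (rule deriv_\<nu>_G)
  moreover have "fd (\<lambda>y. (- 3 * H y) *\<^sub>R Nf y) x v = (- 3 * fd H x v) *\<^sub>R Nf x + (- 3 * H x) *\<^sub>R fd Nf x v" for v
  proof -
    have s: "smooth_on D (\<lambda>y. - 3 * H y)" by (intro smooth_on_mult smooth_on_const smooth_H open_domain)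
    have "fd (\<lambda>y. - 3 * H y) x v = - 3 * fd H x v"
      using deriv_mult[OF smooth_on_const smooth_H x(1), of "-3" v] by simp
    then show ?thesis using deriv_scaleR[OF s smooth_Nf x(1), of v] by simp
  qed
  moreover have "fd (\<lambda>y. H y *\<^sub>R Gf y) x v = fd H x v *\<^sub>R Gf x + H x *\<^sub>R fd Gf x v" for v
    by (rule deriv_scaleR[OF smooth_H smooth_Gf x(1)])
  moreover have "fd \<nu> x ?c = (a * H x) *\<^sub>R Gf x + (b * (- 3 * H x)) *\<^sub>R Nf x"
    using linear_\<nu>[OF x(1)] unfolding b by (simp add: linear_add linear_scale deriv_\<nu>_G[OF x(1)] deriv_\<nu>_N[OF x(1)])
  moreover have "fd H x (G x) = E x" by (simp add: E_def)
  ultimately have "(- 3 * E x) *\<^sub>R Nf x + (- 3 * H x) *\<^sub>R fd Nf x (G x) - H x *\<^sub>R fd Gf x (N x)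
      = (a * H x) *\<^sub>R Gf x + (b * (- 3 * H x)) *\<^sub>R Nf x"
    by (simp add: deriv_H_N[OF x(1)])
  then have "(- 3 * E x) *\<^sub>R Nf x + (- 3 * H x) *\<^sub>R (fd Gf x (N x) + (a *\<^sub>R Gf x + b *\<^sub>R Nf x))
      - H x *\<^sub>R fd Gf x (N x) = (a * H x) *\<^sub>R Gf x + (b * (- 3 * H x)) *\<^sub>R Nf x"
    unfolding 1 .
  then have 2: "(4 * H x) *\<^sub>R fd Gf x (N x) = (- 3 * E x) *\<^sub>R Nf x - (4 * a * H x) *\<^sub>R Gf x"
  proof -
    assume e: "(- 3 * E x) *\<^sub>R Nf x + (- 3 * H x) *\<^sub>R (fd Gf x (N x) + (a *\<^sub>R Gf x + b *\<^sub>R Nf x))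
      - H x *\<^sub>R fd Gf x (N x) = (a * H x) *\<^sub>R Gf x + (b * (- 3 * H x)) *\<^sub>R Nf x"
    show ?thesis
    proof (rule euclidean_eqI)
      fix w :: minkowski
      show "((4 * H x) *\<^sub>R fd Gf x (N x)) \<bullet> w = ((- 3 * E x) *\<^sub>R Nf x - (4 * a * H x) *\<^sub>R Gf x) \<bullet> w"
        using arg_cong[OF e, of "\<lambda>z. z \<bullet> w"] unfolding inner_diff_left inner_add_left inner_scaleR_left
        by algebra
    qed
  qed
  have "lorentz ((4 * H x) *\<^sub>R fd Gf x (N x)) (Gf x) = - 4 * a * H x * E x"
    unfolding 2 using Gf_Nf[OF x(1)] by (simp add: lorentz_simps Gf_Gf[OF x(1)] lorentz_commute[of "Nf x"])
  then have "H x * (4 * lorentz (fd Gf x (N x)) (Gf x)) = H x * (- 4 * a * E x)"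
    unfolding lorentz.scaleR_left real_scaleR_def by algebra
  \<comment> \<open>For \<open>H x = 0\<close>, equation \<open>2\<close> would leave only the term
    with \<open>E x\<close> and \<open>Nf x\<close>, both nonzero.\<close>
  moreover have Hx: "H x \<noteq> 0"
  proof
    assume "H x = 0"
    then have "(- 3 * E x) *\<^sub>R Nf x = 0" using 2 by simp
    then have "Nf x = 0" using x(2) by simp
    then show False using Nf_pos[OF x] by (simp add: lorentz_simps)
  qed
  ultimately have "4 * lorentz (fd Gf x (N x)) (Gf x) = - 4 * a * E x"
    by (metis mult_left_cancel)
  then have "lorentz (fd Gf x (N x)) (Gf x) = - a * E x" by linarith
  \<comment> \<open>\<open>dE(N)\<close> is \<open>- a E\<close> by \<open>EN\<close>, but
    \<open>- 2 a E\<close> by \<open>deriv_E\<close>. So \<open>|grad H|\<close> is constant along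
    the level curves of \<open>H\<close>.\<close>
  then have "a = 0" using EN deriv_E[OF x(1), of "N x"] x(2) by simp
  then show thesis using that[of b] b 1 2 EN Hx by simp
qed

lemma critical_frame:
  assumes "x \<in> D" "E x = 0" shows "Gf x = 0" "Nf x = 0"
  using critical[OF assms] linear_f[OF assms(1)] by (simp_all add: Gf_def Nf_def linear_0)

lemma linear_Gf: "x \<in> D \<Longrightarrow> linear (fd Gf x)"
  using smooth_on_linear_fd[OF smooth_Gf open_domain] .

text \<open>The geodesic curvature of the level curves, extended to critical points, where both
  sides vanish. The extension matters because \<open>gauss\<close> differentiates this
  identity.\<close>

lemma deriv_Gf_N: assumes "x \<in> D" shows "(4 * H x) *\<^sub>R fd Gf x (N x) = (- 3 * E x) *\<^sub>R Nf x"
proof (cases "E x = 0")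
  case True
  then show ?thesis using critical[OF assms True] linear_0[OF linear_Gf[OF assms]] by simp
next
  case False
  then show ?thesis using codazzi[OF assms False] by metis
qed

text \<open>The integral curves of \<open>grad H\<close> are geodesics up to parametrization. Again
  stated on all of \<open>D\<close> in order to be differentiated.\<close>

lemma deriv_Gf_G_Nf: assumes "x \<in> D" shows "lorentz (fd Gf x (G x)) (Nf x) = 0"
proof (cases "E x = 0")
  case True
  then show ?thesis using critical_frame[OF assms True] by (simp add: lorentz_simps)
next
  case False
  obtain b where b: "fd Nf x (G x) = fd Gf x (N x) + b *\<^sub>R Nf x" "H x \<noteq> 0"
    using codazzi[OF assms False] by metis
  have "lorentz (Gf x) ((4 * H x) *\<^sub>R fd Gf x (N x)) = 0"
    unfolding deriv_Gf_N[OF assms] using Gf_Nf[OF assms] by (simp add: lorentz_simps)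
  then have "lorentz (Gf x) (fd Nf x (G x)) = 0" using b Gf_Nf[OF assms] by (simp add: lorentz_simps)
  then show ?thesis using lorentz_deriv_zero[OF smooth_Gf smooth_Nf Gf_Nf assms, of "G x"] by simp
qed

text \<open>The Gauss equation: the bracket \<open>[G, N]\<close> is applied to \<open>Gf\<close>.\<close>

lemma gauss:
  assumes x: "x \<in> D" "E x \<noteq> 0"
  shows "H x * fd E x (G x) = (7/2 * E x + 8/3 * \<rho> * (H x)\<^sup>2 - 8 * (H x)^4) * E x"
proof -
  obtain b where b: "fd N x (G x) - fd G x (N x) = b *\<^sub>R N x"
    "fd Nf x (G x) = fd Gf x (N x) + b *\<^sub>R Nf x" "H x \<noteq> 0"
    using codazzi[OF x] by metis
  define Y Z P m p where defs: "Y = (\<lambda>x. fd Gf x (G x))" "Z = fd Nf x (N x)" "P = (\<lambda>x. fd Gf x (N x))"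
    "m = lorentz (Nf x) (Nf x)" "p = lorentz (P x) (Nf x)"
  define r EG where defs2: "r = lorentz (fd P x (G x)) (Nf x)" "EG = fd E x (G x)"
  have m: "m > 0" using Nf_pos[OF x] by (simp add: defs)
  have sY: "smooth_on D Y" and sP: "smooth_on D P"
    unfolding defs by (intro smooth_on_fd_along smooth_Gf smooth_G smooth_N open_domain)+
  have p: "4 * H x * p = - 3 * E x * m"
    using arg_cong[OF deriv_Gf_N[OF x(1)], of "\<lambda>z. lorentz z (Nf x)"] by (simp add: lorentz_simps defs)
  have sH4: "smooth_on D (\<lambda>y. 4 * H y)" and sE3: "smooth_on D (\<lambda>y. - 3 * E y)"
    by (intro smooth_on_mult smooth_on_const smooth_H smooth_E open_domain)+
  \<comment> \<open>The identity \<open>deriv_Gf_N\<close> is differentiated along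
    \<open>G\<close>.\<close>
  have "fd (\<lambda>y. (4 * H y) *\<^sub>R P y) x (G x) = fd (\<lambda>y. (- 3 * E y) *\<^sub>R Nf y) x (G x)"
    using fd_cong[OF open_domain x(1), of "\<lambda>y. (4 * H y) *\<^sub>R P y"] deriv_Gf_N by (simp add: defs)
  then have "fd (\<lambda>y. 4 * H y) x (G x) *\<^sub>R P x + (4 * H x) *\<^sub>R fd P x (G x)
      = fd (\<lambda>y. - 3 * E y) x (G x) *\<^sub>R Nf x + (- 3 * E x) *\<^sub>R fd Nf x (G x)"
    by (simp only: deriv_scaleR[OF sH4 sP x(1)] deriv_scaleR[OF sE3 smooth_Nf x(1)])
  moreover have "fd (\<lambda>y. 4 * H y) x (G x) = 4 * E x"
    using deriv_mult[OF smooth_on_const smooth_H x(1), of 4 "G x"] by (simp add: E_def)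
  moreover have "fd (\<lambda>y. - 3 * E y) x (G x) = - 3 * EG"
    using deriv_mult[OF smooth_on_const smooth_E x(1), of "- 3" "G x"] by (simp add: defs2)
  ultimately have "(4 * E x) *\<^sub>R P x + (4 * H x) *\<^sub>R fd P x (G x)
      = (- 3 * EG) *\<^sub>R Nf x + (- 3 * E x) *\<^sub>R fd Nf x (G x)" by simp
  from arg_cong[OF this, of "\<lambda>z. lorentz z (Nf x)"]
  have r1: "4 * E x * p + 4 * H x * r = - 3 * EG * m - 3 * E x * (p + b * m)"
    unfolding b(2) by (simp add: lorentz_simps defs defs2 algebra_simps)
  have "fd P x (G x) - fd Y x (N x) = fd Gf x (b *\<^sub>R N x)"
    using bracket_commutator[OF smooth_Gf smooth_G smooth_N open_domain x(1)] unfolding b(1) defs .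
  also have "\<dots> = b *\<^sub>R P x" using linear_Gf[OF x(1)] by (simp add: linear_scale defs)
  finally have "lorentz (fd P x (G x) - fd Y x (N x)) (Nf x) = b * p" by (simp add: lorentz_simps defs)
  \<comment> \<open>The derivative of \<open>Y\<close> along \<open>N\<close> is traded for
    \<open>lorentz (Y x) Z\<close> by differentiating \<open>deriv_Gf_G_Nf\<close>; third
    derivatives of \<open>f\<close> thus remain only in \<open>r\<close>.\<close>
  then have "r - lorentz (fd Y x (N x)) (Nf x) = b * p" by (simp add: lorentz_simps defs2)
  moreover have "lorentz (fd Y x (N x)) (Nf x) + lorentz (Y x) Z = 0"
    using lorentz_deriv_zero[OF sY smooth_Nf _ x(1), of 0] deriv_Gf_G_Nf by (simp add: defs)
  ultimately have r2: "r + lorentz (Y x) Z = b * p" by linarith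
  have t1: "lorentz (t x) (Gf x) = 0" "lorentz (t x) (Nf x) = 0" if "x \<in> D" for x
    using t_orth_f[OF that] by (simp_all add: Gf_def Nf_def)
  have n1: "lorentz (\<nu> x) (Gf x) = 0" "lorentz (\<nu> x) (Nf x) = 0" if "x \<in> D" for x
    using \<nu>_orth[OF that] by (simp_all add: Gf_def Nf_def)
  have GY: "lorentz (Gf x) (Y x) = EG / 2"
    using deriv_E[OF x(1), of "G x"] by (simp add: defs defs2 lorentz_commute[of "Gf x"])
  have GZ: "lorentz (Gf x) Z = - p"
    using lorentz_deriv_zero[OF smooth_Gf smooth_Nf Gf_Nf x(1), of "N x"] by (simp add: defs)
  have NY: "lorentz (Nf x) (Y x) = 0"
    using deriv_Gf_G_Nf[OF x(1)] by (simp add: defs lorentz_commute[of "Nf x"])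
  have nY: "lorentz (\<nu> x) (Y x) = - H x * E x"
    using lorentz_deriv_zero[OF smooth_\<nu> smooth_Gf n1(1) x(1), of "G x"]
    by (simp add: deriv_\<nu>_G[OF x(1)] lorentz_simps Gf_Gf[OF x(1)] defs)
  have nZ: "lorentz (\<nu> x) Z = 3 * H x * m"
    using lorentz_deriv_zero[OF smooth_\<nu> smooth_Nf n1(2) x(1), of "N x"]
    by (simp add: deriv_\<nu>_N[OF x(1)] lorentz_simps defs)
  have tY: "lorentz (t x) (Y x) = - \<kappa> * E x"
    using lorentz_deriv_zero[OF smooth_t smooth_Gf t1(1) x(1), of "G x"]
    by (simp add: fd_t[OF x(1)] Gf_def[symmetric] lorentz_simps Gf_Gf[OF x(1)] defs)
  have tZ: "lorentz (t x) Z = - \<kappa> * m"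
    using lorentz_deriv_zero[OF smooth_t smooth_Nf t1(2) x(1), of "N x"]
    by (simp add: fd_t[OF x(1)] Nf_def[symmetric] lorentz_simps defs)
  \<comment> \<open>The terms of \<open>t\<close> and \<open>\<nu>\<close> give
    \<open>\<rho>\<close> and \<open>- 3 H^2\<close>, whose sum is the Gauss curvature; that of
    \<open>Gf\<close> brings in \<open>p\<close>, and that of \<open>Nf\<close> vanishes by
    \<open>NY\<close>.\<close>
  have "lorentz (Y x) Z = lorentz (t x) (Y x) * lorentz (t x) Z / lorentz (t x) (t x)
    + lorentz (\<nu> x) (Y x) * lorentz (\<nu> x) Z / lorentz (\<nu> x) (\<nu> x)
    + lorentz (Gf x) (Y x) * lorentz (Gf x) Z / lorentz (Gf x) (Gf x)
    + lorentz (Nf x) (Y x) * lorentz (Nf x) Z / lorentz (Nf x) (Nf x)"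
  proof (rule lorentz_parseval)
    show "lorentz (t x) (t x) \<noteq> 0" using t_timelike[OF x(1)] by simp
    show "lorentz (t x) (\<nu> x) = 0" using \<nu>_orth_t[OF x(1)] lorentz_commute by metis
  qed (use m x t1 n1 \<nu>_unit Gf_Gf Gf_Nf in \<open>simp_all add: defs\<close>)
  also have "\<dots> = (\<kappa> * \<kappa> / lorentz (t x) (t x)) * (E x * m) - 3 * (H x)\<^sup>2 * E x * m - EG * p / (2 * E x)"
    unfolding tY tZ nY nZ GY GZ NY \<nu>_unit[OF x(1)] Gf_Gf[OF x(1)] by (simp add: power2_eq_square)
  finally have YZ: "lorentz (Y x) Z = \<rho> * (E x * m) - 3 * (H x)\<^sup>2 * E x * m - EG * p / (2 * E x)"
    unfolding \<kappa>_t[OF x(1)] .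
  have "4 * H x * (EG * p / (2 * E x)) = EG / (2 * E x) * (4 * H x * p)" by simp
  also have "\<dots> = - (3/2) * m * EG" unfolding p using x(2) by (simp add: field_simps)
  finally have q: "4 * H x * (EG * p / (2 * E x)) = - (3/2) * m * EG" .
  define z where "z = EG * p / (2 * E x)"
  \<comment> \<open>The unknown coefficient \<open>b\<close> appears here and in \<open>r1\<close>
    only as \<open>- 3 E m b\<close>, once \<open>4 H p = - 3 E m\<close> is used, and
    cancels.\<close>
  have "4 * H x * r + 4 * H x * (\<rho> * (E x * m) - 3 * (H x)\<^sup>2 * E x * m - z) = b * (4 * H x * p)"
    using arg_cong[OF r2[unfolded YZ], of "\<lambda>a. 4 * H x * a"] by (simp add: z_def algebra_simps)
  then have "3 / 2 * m * EG = - 7 * E x * p - 12 * (H x)^3 * E x * m + 4 * H x * \<rho> * E x * m"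
    using r1 p q[folded z_def] by algebra
  \<comment> \<open>Multiply by \<open>2/3 H\<close> and eliminate \<open>p\<close>:
    \<open>- 14/3 E H p\<close> becomes \<open>7/2 E^2 m\<close>.\<close>
  then have "m * (H x * EG) = m * ((7/2 * E x + 8/3 * \<rho> * (H x)\<^sup>2 - 8 * (H x)^4) * E x)"
    using p by algebra
  then show ?thesis using m by (simp add: defs2)
qed

text \<open>\<open>dE\<close> vanishes on \<open>N\<close>, so \<open>gauss\<close> determines it.
  Formally \<open>E\<close> is a function of \<open>H\<close> with
  \<open>H E' = 7/2 E + 8/3 \<rho> H^2 - 8 H^4\<close>; for \<open>H > 0\<close> the integrating
  factor \<open>H powr (-9/2)\<close> leads to \<open>first_integral\<close>.\<close>

lemma hessian_identity:
  assumes "x \<in> D"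
  shows "H x * fd E x v = (7/2 * E x + 8/3 * \<rho> * (H x)\<^sup>2 - 8 * (H x)^4) * fd H x v"
proof (cases "E x = 0")
  case True
  then show ?thesis using critical(2)[OF assms True] deriv_E[OF assms] critical_frame[OF assms True]
    by (simp add: lorentz_simps)
next
  case False
  obtain b where b: "v = (fd H x v / E x) *\<^sub>R G x + b *\<^sub>R N x" using frame_coordinates[OF assms False] .
  have l: "linear (fd E x)" using smooth_on_linear_fd[OF smooth_E open_domain assms] .
  have EN: "fd E x (N x) = 0" using codazzi[OF assms False] by metis
  have "fd E x v = fd H x v / E x * fd E x (G x)"
    using arg_cong[OF b, of "fd E x"] by (simp add: linear_add[OF l] linear_scale[OF l] EN)
  then have "H x * fd E x v = fd H x v / E x * (H x * fd E x (G x))" by simp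
  then show ?thesis unfolding gauss[OF assms False] using False by simp
qed

section \<open>Local constancy of the first integral\<close>

lemma smooth_H2: "smooth_on D (\<lambda>x. (H x)\<^sup>2)"
  unfolding power2_eq_square by (intro smooth_on_mult smooth_H open_domain)

lemma deriv_H2: "x \<in> D \<Longrightarrow> fd (\<lambda>x. (H x)\<^sup>2) x v = 2 * H x * fd H x v"
  unfolding power2_eq_square by (simp add: deriv_mult[OF smooth_H smooth_H])

lemma grad_norm2_H2: assumes "x \<in> D" shows "grad_norm2 f (\<lambda>x. (H x)\<^sup>2) x = 4 * (H x)\<^sup>2 * E x"
proof -
  have l: "linear (fd (\<lambda>x. (H x)\<^sup>2) x)" using smooth_on_linear_fd[OF smooth_H2 open_domain assms] .
  have "surface_grad f (\<lambda>x. (H x)\<^sup>2) x = (2 * H x) *\<^sub>R G x"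
    by (rule metric_ext[OF assms])
      (simp add: metric_surface_grad[OF assms l] deriv_H2[OF assms] metric_bilinear[OF assms] metric_G[OF assms])
  then show ?thesis unfolding grad_norm2_def
    by (simp add: metric_bilinear[OF assms] E_eq[OF assms] power2_eq_square)
qed

lemma first_integral_derivative:
  assumes "x \<in> D" "H x \<noteq> 0"
  shows "((\<lambda>y. first_integral \<rho> ((H y)\<^sup>2) (grad_norm2 f (\<lambda>x. (H x)\<^sup>2) y)) has_derivative (\<lambda>_. 0)) (at x)"
proof -
  have dE: "(E has_derivative fd E x) (at x)" and dH: "(H has_derivative fd H x) (at x)"
    using smooth_on_has_derivative[OF _ open_domain assms(1)] smooth_E smooth_H by blast+
  have pos: "(H x)\<^sup>2 > 0" using assms(2) by simp
  \<comment> \<open>The lowest exponent after differentiation is -15/4 and all others exceed it by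
    integers. With \<open>u\<close> factored out the claim is polynomial.\<close>
  define u where "u = (H x)\<^sup>2 powr (-15/4)"
  have u: "(H x)\<^sup>2 powr (-11/4) = u * (H x)^2" "(H x)\<^sup>2 powr (-3/4) = u * (H x)^6"
     "(H x)\<^sup>2 powr (-7/4) = u * (H x)^4"
  proof -
    have "(H x)\<^sup>2 powr (-15/4 + real n) = u * ((H x)\<^sup>2) ^ n" for n
      using pos by (simp only: powr_add powr_realpow u_def)
    from this[of 1] this[of 3] this[of 2]
    show "(H x)\<^sup>2 powr (-11/4) = u * (H x)^2" "(H x)\<^sup>2 powr (-3/4) = u * (H x)^6"
     "(H x)\<^sup>2 powr (-7/4) = u * (H x)^4"
      by (simp_all flip: power_mult)
  qed
  have dp: "((\<lambda>y. ((H y)\<^sup>2) powr a) has_derivative (\<lambda>v. a * ((H x)\<^sup>2) powr (a - 1) * (2 * H x * fd H x v))) (at x)" for a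
  proof -
    have "((\<lambda>y. (H y)\<^sup>2) has_derivative (\<lambda>v. 2 * H x * fd H x v)) (at x)"
      using has_derivative_power[OF dH, of 2] by (simp add: mult_ac)
    moreover have "((\<lambda>z. z powr a) has_derivative (\<lambda>v. v * (a * ((H x)\<^sup>2) powr (a - 1)))) (at ((H x)\<^sup>2))"
      using has_real_derivative_powr[OF pos, of a] unfolding has_field_derivative_def
      by (rule has_derivative_eq_rhs) (simp add: fun_eq_iff mult.commute)
    ultimately have "((\<lambda>y. ((H y)\<^sup>2) powr a) has_derivative
        (\<lambda>v. (2 * H x * fd H x v) * (a * ((H x)\<^sup>2) powr (a - 1)))) (at x)"
      by (rule has_derivative_compose)
    then show ?thesis by (rule has_derivative_eq_rhs) (simp add: fun_eq_iff)
  qed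
  have "((\<lambda>y. 9/64 * (4 * (H y)\<^sup>2 * E y) * (H y)\<^sup>2 powr (-11/4) + 9 * (H y)\<^sup>2 powr (1/4) + \<rho> * (H y)\<^sup>2 powr (-3/4)) has_derivative
    (\<lambda>v. (9/64 * (4 * (H x)\<^sup>2 * E x) * (-11/4 * ((H x)\<^sup>2) powr (-11/4 - 1) * (2 * H x * fd H x v))
        + 9/64 * (4 * (2 * H x * fd H x v) * E x + 4 * (H x)\<^sup>2 * fd E x v) * (H x)\<^sup>2 powr (-11/4))
      + 9 * (1/4 * ((H x)\<^sup>2) powr (1/4 - 1) * (2 * H x * fd H x v))
      + \<rho> * (-3/4 * ((H x)\<^sup>2) powr (-3/4 - 1) * (2 * H x * fd H x v)))) (at x)"
    by (rule derivative_eq_intros dp dE dH refl | simp add: algebra_simps)+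
  then have "((\<lambda>y. 9/64 * (4 * (H y)\<^sup>2 * E y) * (H y)\<^sup>2 powr (-11/4) + 9 * (H y)\<^sup>2 powr (1/4) + \<rho> * (H y)\<^sup>2 powr (-3/4))
    has_derivative (\<lambda>v. 0)) (at x)"
  proof (rule has_derivative_eq_rhs, intro ext)
    fix v show "(9/64 * (4 * (H x)\<^sup>2 * E x) * (-11/4 * ((H x)\<^sup>2) powr (-11/4 - 1) * (2 * H x * fd H x v))
        + 9/64 * (4 * (2 * H x * fd H x v) * E x + 4 * (H x)\<^sup>2 * fd E x v) * (H x)\<^sup>2 powr (-11/4))
      + 9 * (1/4 * ((H x)\<^sup>2) powr (1/4 - 1) * (2 * H x * fd H x v))
      + \<rho> * (-3/4 * ((H x)\<^sup>2) powr (-3/4 - 1) * (2 * H x * fd H x v)) = 0"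
    proof -
    have "(9/64 * (4 * (H x)\<^sup>2 * E x) * (-11/4 * u * (2 * H x * fd H x v))
        + 9/64 * (4 * (2 * H x * fd H x v) * E x + 4 * (H x)\<^sup>2 * fd E x v) * (u * (H x)^2))
      + 9 * (1/4 * (u * (H x)^6) * (2 * H x * fd H x v))
      + \<rho> * (-3/4 * (u * (H x)^4) * (2 * H x * fd H x v)) = 0"
      using hessian_identity[OF assms(1), of v] by algebra
    then show ?thesis using u by (simp add: u_def)
    qed
  qed
  then show ?thesis
    by (rule has_derivative_transform_within_open[OF _ open_domain assms(1)])
      (simp add: first_integral_def grad_norm2_H2)
qed

end

section \<open>Change of the normal and of the parametrization\<close>

text \<open>The part of \<open>\<nu>'\<close> orthogonal to \<open>\<nu>\<close> is both tangent and
  normal, hence zero. The sign \<open>s\<close> may depend on the point; squares of mean curvatures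
  do not see it.\<close>

lemma (in oriented_patch) normal_unique:
  assumes "oriented_patch \<rho> D f \<nu>'" "x \<in> D"
  obtains s where "s = 1 \<or> s = - 1" "\<nu>' x = s *\<^sub>R \<nu> x"
    "mean_curvature \<rho> f \<nu>' x = s * mean_curvature \<rho> f \<nu> x"
proof -
  interpret P': oriented_patch \<rho> D f \<nu>' by fact
  define s where "s = lorentz (\<nu>' x) (\<nu> x)"
  let ?y = "\<nu>' x - s *\<^sub>R \<nu> x"
  have "lorentz ?y (\<nu> x) = 0" by (simp add: lorentz_simps \<nu>_unit[OF assms(2)] s_def)
  moreover have "lorentz ?y (t x) = 0"
    by (simp add: lorentz_simps \<nu>_orth_t[OF assms(2)] P'.\<nu>_orth_t[OF assms(2)])
  ultimately obtain w where w: "fd f x w = ?y" using tangent_in_range[OF assms(2)] by blast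
  have "g x w w = lorentz ?y (fd f x w)" by (simp add: induced_metric_def w)
  also have "\<dots> = 0" by (simp add: lorentz_simps \<nu>_orth[OF assms(2)] P'.\<nu>_orth[OF assms(2)])
  finally have "w = 0" using metric_pos[OF assms(2), of w] by force
  then have e: "\<nu>' x = s *\<^sub>R \<nu> x" using w linear_f[OF assms(2)] by (simp add: linear_0)
  have "lorentz (\<nu>' x) (\<nu>' x) = s\<^sup>2 * lorentz (\<nu> x) (\<nu> x)"
    unfolding e by (simp add: lorentz_simps power2_eq_square)
  then have s: "s = 1 \<or> s = - 1"
    using \<nu>_unit[OF assms(2)] P'.\<nu>_unit[OF assms(2)] by (simp add: power2_eq_1_iff)
  have sh: "sharp x (s * a) (s * b) = s *\<^sub>R sharp x a b" for a b
    by (simp add: sharp_def algebra_simps)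
  have "mean_curvature \<rho> f \<nu>' x = s * mean_curvature \<rho> f \<nu> x"
    unfolding P'.mean_curvature_nth[OF assms(2)] mean_curvature_nth[OF assms(2)]
      P'.shape_sharp[OF assms(2)] shape_sharp[OF assms(2)] e
      lorentz.scaleR_left real_scaleR_def sh
    by (simp add: algebra_simps)
  with s e that show thesis by blast
qed

text \<open>Normalise the vector product of \<open>t\<close> and the two coordinate fields; its
  squared length is \<open>- lorentz t t\<close> times the Gram determinant, hence positive.\<close>

lemma (in immersed_patch) normal_exists: "\<exists>\<nu>. oriented_patch \<rho> D f \<nu>"
proof -
  define n where "n x = lorentz_cross (t x) (fd f x e1) (fd f x e2)" for x
  define q where "q x = lorentz (n x) (n x)" for x
  define \<nu> where "\<nu> x = q x powr (-1/2) *\<^sub>R n x" for x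
  have sn: "smooth_on D n"
    unfolding n_def by (intro smooth_on_lorentz_cross smooth_t smooth_on_fd smooth_f open_domain)
  have q: "q x > 0" if "x \<in> D" for x
  proof -
    have "q x = - lorentz (t x) (t x) * gram x"
      unfolding q_def n_def gram_def induced_metric_def
      by (rule lorentz_cross_norm) (rule t_orth_f[OF that])+
    then show ?thesis using gram_pos[OF that] t_timelike[OF that] by (simp add: mult_neg_pos)
  qed
  have orth: "lorentz (n x) (fd f x v) = 0" if "x \<in> D" for x v
  proof -
    have "lorentz (fd f x e1) (n x) = 0" "lorentz (fd f x e2) (n x) = 0"
      unfolding n_def by (rule lorentz_cross_orthogonal)+
    then show ?thesis
      unfolding linear_vec2[OF linear_f[OF that], of v] by (simp add: lorentz_simps lorentz_commute[of "n x"])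
  qed
  have "oriented_patch \<rho> D f \<nu>"
  proof
    show "smooth_on D \<nu>"
      unfolding \<nu>_def
      by (intro smooth_on_scaleR smooth_on_powr q open_domain sn) (simp_all add: q_def smooth_on_lorentz sn open_domain)
    show "\<nu> x \<in> space_form_tangent \<rho> (f x)" for x
      unfolding space_form_tangent_iff t_def[symmetric] \<nu>_def
      by (simp add: lorentz_simps n_def lorentz_cross_orthogonal)
    show "lorentz (\<nu> x) (\<nu> x) = 1" if "x \<in> D" for x
    proof -
      have "lorentz (\<nu> x) (\<nu> x) = (q x powr (-1/2) * q x powr (-1/2)) * q x"
        by (simp add: \<nu>_def lorentz_simps q_def)
      also have "\<dots> = q x powr (-1/2 + -1/2) * q x" by (simp only: powr_add)
      also have "\<dots> = 1" using q[OF that] by (simp add: powr_minus)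
      finally show ?thesis .
    qed
    show "lorentz (\<nu> x) (fd f x v) = 0" if "x \<in> D" for x v
      using orth[OF that] by (simp add: \<nu>_def lorentz_simps)
  qed
  then show ?thesis by blast
qed

section \<open>Restriction and change of coordinates\<close>

lemma immersed_patch_subset:
  assumes "immersed_patch \<rho> D f" "open D'" "D' \<subseteq> D" shows "immersed_patch \<rho> D' f"
  using assms smooth_on_subset unfolding immersed_patch_def by blast

lemma oriented_patch_subset:
  assumes "oriented_patch \<rho> D f \<nu>" "open D'" "D' \<subseteq> D" shows "oriented_patch \<rho> D' f \<nu>"
  using assms immersed_patch_subset smooth_on_subset
  unfolding oriented_patch_def oriented_patch_axioms_def by blast

text \<open>A chart transition seen in one direction. Its differential is invertible because
  \<open>f'\<close> is itself an immersion, so no inverse map is carried along.\<close>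

locale reparametrization =
  P: immersed_patch \<rho> D f + P': immersed_patch \<rho> D' f' for \<rho> D f D' f' +
  fixes \<phi> :: "real^2 \<Rightarrow> real^2"
  assumes smooth_\<phi>: "smooth_on D' \<phi>" and \<phi>_in: "\<And>y. y \<in> D' \<Longrightarrow> \<phi> y \<in> D"
    and f'_eq: "\<And>y. y \<in> D' \<Longrightarrow> f' y = f (\<phi> y)"
begin

lemma fd_reparam:
  assumes "smooth_on D a" "\<And>y. y \<in> D' \<Longrightarrow> b y = a (\<phi> y)" "y \<in> D'"
  shows "fd b y v = fd a (\<phi> y) (fd \<phi> y v)"
  using fd_compose[OF smooth_\<phi> P'.open_domain assms(3,1) P.open_domain \<phi>_in[OF assms(3)]]
    fd_cong[OF P'.open_domain assms(3), of b "\<lambda>y. a (\<phi> y)"] assms(2) by simp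

lemma linear_\<phi>: "y \<in> D' \<Longrightarrow> linear (fd \<phi> y)"
  using smooth_on_linear_fd[OF smooth_\<phi> P'.open_domain] .

lemma metric_reparam: "y \<in> D' \<Longrightarrow> induced_metric f' y v w = induced_metric f (\<phi> y) (fd \<phi> y v) (fd \<phi> y w)"
  by (simp add: induced_metric_def fd_reparam[OF P.smooth_f f'_eq])

lemma inj_\<phi>: assumes "y \<in> D'" shows "inj (fd \<phi> y)"
proof (rule injI)
  fix v w assume "fd \<phi> y v = fd \<phi> y w"
  then have "fd f' y v = fd f' y w" by (simp add: fd_reparam[OF P.smooth_f f'_eq assms])
  then show "v = w" using P'.inj_f[OF assms] by (simp add: inj_eq)
qed

lemma surj_\<phi>: "y \<in> D' \<Longrightarrow> surj (fd \<phi> y)"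
  by (rule linear_injective_imp_surjective[OF linear_\<phi> inj_\<phi>]) auto

text \<open>\<open>d\<phi>\<close> maps one gradient to the other: tested against vectors
  \<open>d\<phi> w\<close>, which are all vectors by surjectivity, both give the same derivative of
  \<open>h\<close>.\<close>

lemma grad_norm2_reparam:
  assumes "smooth_on D h" "smooth_on D' h'" "\<And>y. y \<in> D' \<Longrightarrow> h' y = h (\<phi> y)" "y \<in> D'"
  shows "grad_norm2 f' h' y = grad_norm2 f h (\<phi> y)"
proof -
  note l = smooth_on_linear_fd[OF assms(1) P.open_domain \<phi>_in[OF assms(4)]]
  note l' = smooth_on_linear_fd[OF assms(2) P'.open_domain assms(4)]
  have "fd \<phi> y (surface_grad f' h' y) = surface_grad f h (\<phi> y)"
  proof (rule P.metric_ext[OF \<phi>_in[OF assms(4)]])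
    fix v
    obtain w where w: "v = fd \<phi> y w" using surj_\<phi>[OF assms(4)] by (metis surjD)
    show "induced_metric f (\<phi> y) (fd \<phi> y (surface_grad f' h' y)) v
        = induced_metric f (\<phi> y) (surface_grad f h (\<phi> y)) v"
      unfolding w metric_reparam[OF assms(4), symmetric] P'.metric_surface_grad[OF assms(4) l']
        P.metric_surface_grad[OF \<phi>_in[OF assms(4)] l]
      by (rule fd_reparam[OF assms(1,3,4)])
  qed
  then show ?thesis unfolding grad_norm2_def metric_reparam[OF assms(4)] by simp
qed

text \<open>\<open>d\<phi>\<close> intertwines the two shape operators, so their matrices are
  similar and have the same trace.\<close>

lemma mean_curvature_reparam:
  assumes "oriented_patch \<rho> D f \<nu>" "oriented_patch \<rho> D' f' \<nu>'"
    "\<And>y. y \<in> D' \<Longrightarrow> \<nu>' y = \<nu> (\<phi> y)" "y \<in> D'"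
  shows "mean_curvature \<rho> f' \<nu>' y = mean_curvature \<rho> f \<nu> (\<phi> y)"
proof -
  interpret Q: oriented_patch \<rho> D f \<nu> by fact
  interpret Q': oriented_patch \<rho> D' f' \<nu>' by fact
  let ?x = "\<phi> y"
  note x = \<phi>_in[OF assms(4)]
  let ?M = "matrix (fd \<phi> y)" and ?A = "matrix (Q.S ?x)" and ?A' = "matrix (Q'.S y)"
  have c: "fd \<phi> y (Q'.S y v) = Q.S ?x (fd \<phi> y v)" for v
  proof -
    have "fd f ?x (fd \<phi> y (Q'.S y v)) = - fd \<nu>' y v"
      using Q'.fd_f_shape[OF assms(4), of v] fd_reparam[OF P.smooth_f f'_eq assms(4)] by simp
    also have "\<dots> = fd f ?x (Q.S ?x (fd \<phi> y v))"
      using Q.fd_f_shape[OF x] fd_reparam[OF Q.smooth_\<nu> assms(3,4)] by simp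
    finally show ?thesis using P.inj_f[OF x] by (simp add: inj_eq)
  qed
  have "?M ** ?A' = ?A ** ?M"
    using c matrix_compose[OF Q'.linear_shape[OF assms(4)] linear_\<phi>[OF assms(4)]]
      matrix_compose[OF linear_\<phi>[OF assms(4)] Q.linear_shape[OF x]] by (simp add: comp_def)
  moreover obtain B where B: "B ** ?M = mat 1"
  proof -
    have "inj ((*v) ?M)"
      using inj_\<phi>[OF assms(4)] matrix_vector_mul(2)[OF linear_\<phi>[OF assms(4)]] by simp
    then show ?thesis using that matrix_left_invertible_injective[of ?M] by blast
  qed
  moreover from B have B': "?M ** B = mat 1" by (simp add: matrix_left_right_inverse)
  ultimately have "trace ?A' = trace (B ** (?A ** ?M))"
    by (metis matrix_mul_assoc matrix_mul_lid)
  also have "\<dots> = trace ((?A ** ?M) ** B)" by (rule trace_mul_sym)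
  also have "\<dots> = trace ?A" by (metis B' matrix_mul_assoc matrix_mul_rid)
  finally show ?thesis by (simp add: mean_curvature_def)
qed

end

lemma (in immersed_patch) grad_norm2_cong:
  assumes "\<And>y. y \<in> D \<Longrightarrow> h y = k y" "x \<in> D"
  shows "grad_norm2 f h x = grad_norm2 f k x"
  using fd_cong[OF open_domain assms(2), of h k] assms(1) by (simp add: grad_norm2_def surface_grad_def)

section \<open>The first integral controls the zeros of the mean curvature\<close>

text \<open>What the global argument needs to know about the squared mean curvature, freed from the
  normal field, which exists only locally.\<close>

locale conserved_patch = immersed_patch +
  fixes h :: "real^2 \<Rightarrow> real"
  assumes smooth_h: "smooth_on D h" and h_nonneg: "\<And>x. x \<in> D \<Longrightarrow> h x \<ge> 0"
    and conserved: "\<And>x. x \<in> D \<Longrightarrow> h x > 0 \<Longrightarrow>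
      ((\<lambda>y. first_integral \<rho> (h y) (grad_norm2 f h y)) has_derivative (\<lambda>_. 0)) (at x)"
begin

definition Q where "Q x = first_integral \<rho> (h x) (grad_norm2 f h x)"

lemma linear_h: "x \<in> D \<Longrightarrow> linear (fd h x)"
  using smooth_on_linear_fd[OF smooth_h open_domain] .

text \<open>Solve the first integral for the gradient term, that is, multiply by
  \<open>h powr (11/4)\<close>. The term \<open>- 9 h^3\<close> is dropped, and
  \<open>h powr (11/4) \<le> M powr (3/4) * h^2\<close> leaves a multiple of
  \<open>h^2\<close>.\<close>

lemma grad_norm2_bound:
  assumes "x \<in> D" "0 < h x" "h x \<le> M"
  shows "grad_norm2 f h x \<le> 64/9 * (\<bar>Q x\<bar> * M powr (3/4) - \<rho>) * (h x)\<^sup>2"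
proof -
  define u where "u = h x powr (-11/4)"
  have u0: "u > 0" using assms by (simp add: u_def)
  have u: "h x powr (1/4) = u * (h x)^3" "h x powr (-3/4) = u * (h x)^2"
  proof -
    have "h x powr (-11/4 + real n) = u * (h x) ^ n" for n
      using assms by (simp only: powr_add powr_realpow u_def)
    from this[of 3] this[of 2] show "h x powr (1/4) = u * (h x)^3" "h x powr (-3/4) = u * (h x)^2"
      by simp_all
  qed
  have u1: "u * h x powr (3/4) * (h x)^2 = 1"
  proof -
    have "u * h x powr (3/4) * (h x)^2 = u * h x powr (3/4) * h x powr (real 2)"
      using assms powr_realpow[of "h x" 2] by simp
    also have "\<dots> = h x powr (-11/4 + 3/4 + real 2)" by (simp only: powr_add u_def)
    also have "\<dots> = 1" using assms by simp
    finally show ?thesis .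
  qed
  have "Q x = 9/64 * grad_norm2 f h x * u + 9 * (u * (h x)^3) + \<rho> * (u * (h x)^2)"
    unfolding Q_def first_integral_def u by (simp add: u_def)
  then have "9/64 * grad_norm2 f h x * u = Q x * 1 - 9 * (u * (h x)^3) - \<rho> * (u * (h x)^2)" by simp
  also have "\<dots> = u * (Q x * h x powr (3/4) * (h x)^2 - 9 * (h x)^3 - \<rho> * (h x)^2)"
    unfolding u1[symmetric] by (simp add: algebra_simps)
  finally have "9/64 * grad_norm2 f h x = Q x * h x powr (3/4) * (h x)^2 - 9 * (h x)^3 - \<rho> * (h x)^2"
    using u0 by simp
  moreover have "Q x * h x powr (3/4) * (h x)^2 \<le> \<bar>Q x\<bar> * M powr (3/4) * (h x)^2"
  proof -
    have "Q x * h x powr (3/4) \<le> \<bar>Q x\<bar> * h x powr (3/4)" by (intro mult_right_mono) auto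
    also have "\<dots> \<le> \<bar>Q x\<bar> * M powr (3/4)" using assms by (intro mult_left_mono powr_mono2) auto
    finally show ?thesis by (intro mult_right_mono) auto
  qed
  moreover have "(h x)^3 > 0" using assms by simp
  ultimately have "9/64 * grad_norm2 f h x \<le> \<bar>Q x\<bar> * M powr (3/4) * (h x)^2 - \<rho> * (h x)^2" by linarith
  then show ?thesis by (simp add: algebra_simps)
qed

text \<open>On a segment along which \<open>h > 0\<close> the first integral is constant, so
  \<open>\<bar>dh\<bar> \<le> L h\<close> for some \<open>L\<close> and \<open>h\<close> cannot decrease to \<open>0\<close>.\<close>

lemma positive_along_segment:
  assumes seg: "closed_segment y x \<subseteq> D" and hy: "h y > 0" and M: "\<And>z. z \<in> D \<Longrightarrow> h z \<le> M"
  shows "h x > 0"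
proof (rule ccontr)
  assume "\<not> h x > 0"
  define v where "v = x - y"
  define \<gamma> where "\<gamma> s = y + s *\<^sub>R v" for s
  have \<gamma>: "\<gamma> s \<in> D" if "0 \<le> s" "s \<le> 1" for s
    using seg that unfolding \<gamma>_def v_def closed_segment_def
    by (fastforce simp: algebra_simps)
  have d\<gamma>: "(\<gamma> has_derivative (\<lambda>r. r *\<^sub>R v)) (at s within T)" for s T
    unfolding \<gamma>_def by (auto intro!: derivative_eq_intros)
  have "x \<in> D" using seg by auto
  then have hx: "h (\<gamma> 1) = 0" using \<open>\<not> h x > 0\<close> h_nonneg[of x] by (simp add: \<gamma>_def v_def)
  have du: "((\<lambda>s. h (\<gamma> s)) has_real_derivative fd h (\<gamma> s) v) (at s)" if "0 \<le> s" "s \<le> 1" for s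
    using has_derivative_compose[OF d\<gamma> smooth_on_has_derivative[OF smooth_h open_domain \<gamma>[OF that]], of UNIV]
    by (simp add: has_field_derivative_def linear_scale[OF linear_h[OF \<gamma>[OF that]]] mult.commute[of _ "fd h (\<gamma> s) v"])
  have cu: "continuous_on {0..1} (\<lambda>s. h (\<gamma> s))"
    by (intro continuous_at_imp_continuous_on ballI) (rule DERIV_isCont[OF du], auto)
  let ?T = "{s \<in> {0..1}. h (\<gamma> s) = 0}"
  have clT: "closed ?T" using continuous_closed_preimage_constant[OF cu] by simp
  have T: "?T \<noteq> {}" "bdd_below ?T" using hx by (auto intro: bdd_belowI[of _ 0])
  \<comment> \<open>The first zero met when coming from \<open>y\<close>; before it \<open>h\<close>
    is positive, so the first integral can be used on \<open>[0, s0)\<close>.\<close>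
  define s0 where "s0 = Inf ?T"
  have "s0 \<in> ?T" unfolding s0_def by (rule closed_contains_Inf[OF T clT])
  then have s0: "0 \<le> s0" "s0 \<le> 1" "h (\<gamma> s0) = 0" by auto
  have s0pos: "s0 > 0" using s0 hy by (cases "s0 = 0") (auto simp: \<gamma>_def)
  have upos: "h (\<gamma> s) > 0" if "0 \<le> s" "s < s0" for s
  proof -
    have "s \<notin> ?T" using cInf_lower[OF _ T(2), of s] that(2) unfolding s0_def by (meson not_less)
    then show ?thesis using that s0 h_nonneg[OF \<gamma>[of s]] by force
  qed
  have "\<exists>C. \<forall>s\<in>{0..<s0}. Q (\<gamma> s) = C"
  proof (rule has_derivative_zero_constant)
    show "((\<lambda>s. Q (\<gamma> s)) has_derivative (\<lambda>h. 0)) (at s within {0..<s0})" if "s \<in> {0..<s0}" for s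
      using has_derivative_compose[OF d\<gamma> conserved[OF \<gamma>[of s] upos[of s]], of "{0..<s0}"] that s0
      by (simp add: Q_def)
  qed simp
  then obtain C where C: "\<And>s. 0 \<le> s \<Longrightarrow> s < s0 \<Longrightarrow> Q (\<gamma> s) = C" by auto
  have c\<gamma>: "continuous_on {0..1} \<gamma>" unfolding \<gamma>_def by (intro continuous_intros)
  have "smooth_on D (\<lambda>z. g z v v)" by (intro smooth_metric smooth_on_const)
  then have "continuous_on {0..1} (\<lambda>s. g (\<gamma> s) v v)"
    by (rule continuous_on_compose2[OF smooth_on_imp_continuous_on c\<gamma>]) (use \<gamma> in auto)
  then have "compact ((\<lambda>s. g (\<gamma> s) v v) ` {0..1})" by (intro compact_continuous_image) auto
  then obtain B where B: "\<And>s. 0 \<le> s \<Longrightarrow> s \<le> 1 \<Longrightarrow> g (\<gamma> s) v v \<le> B"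
    using bounded_imp_bdd_above[OF compact_imp_bounded] unfolding bdd_above_def by fastforce
  define K where "K = 64/9 * (\<bar>C\<bar> * M powr (3/4) - \<rho>)"
  have K: "K \<ge> 0" using curvature_nonpos order_trans[of \<rho> 0 "\<bar>C\<bar> * M powr (3/4)"] by (simp add: K_def)
  have B0: "B \<ge> 0" using B[of 0] metric_pos[OF \<gamma>[of 0], of v] metric_zero[OF \<gamma>[of 0]]
    by (cases "v = 0") auto
  \<comment> \<open>Cauchy-Schwarz bounds the squared derivative along the segment by
    \<open>|grad h|^2 |v|^2 \<le> K h^2 B\<close>.\<close>
  define L where "L = sqrt (K * B)"
  have L: "\<bar>fd h (\<gamma> s) v\<bar> \<le> L * h (\<gamma> s)" if s: "0 \<le> s" "s < s0" for s
  proof -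
    have inD: "\<gamma> s \<in> D" using \<gamma> s s0 by simp
    note p = upos[OF s]
    have "(fd h (\<gamma> s) v)\<^sup>2 = (g (\<gamma> s) (surface_grad f h (\<gamma> s)) v)\<^sup>2"
      using metric_surface_grad[OF inD linear_h[OF inD]] by simp
    also have "\<dots> \<le> grad_norm2 f h (\<gamma> s) * g (\<gamma> s) v v"
      unfolding grad_norm2_def by (rule metric_cauchy_schwarz[OF inD])
    also have "\<dots> \<le> (K * (h (\<gamma> s))\<^sup>2) * B"
    proof (rule mult_mono)
      show "grad_norm2 f h (\<gamma> s) \<le> K * (h (\<gamma> s))\<^sup>2"
        using grad_norm2_bound[OF inD p M[OF inD]] C[OF s] by (simp add: K_def)
      show "g (\<gamma> s) v v \<le> B" using B s s0 by simp
      show "0 \<le> K * (h (\<gamma> s))\<^sup>2" using K by simp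
      show "0 \<le> g (\<gamma> s) v v"
        using metric_pos[OF inD, of v] metric_zero[OF inD] by (cases "v = 0") auto
    qed
    also have "\<dots> = (L * h (\<gamma> s))\<^sup>2" using K B0 by (simp add: L_def power_mult_distrib)
    finally show ?thesis
      using p K B0 by (intro abs_le_square_iff[THEN iffD2, of "fd h (\<gamma> s) v" "L * h (\<gamma> s)", THEN order_trans])
        (auto simp: L_def)
  qed
  \<comment> \<open>Gronwall argument: the derivative of \<open>h\<close> along the segment is at
    least \<open>- L h\<close>, so \<open>h exp (L s)\<close> does not decrease.\<close>
  have "h (\<gamma> 0) * exp (L * 0) \<le> h (\<gamma> s0) * exp (L * s0)"
  proof (rule DERIV_nonneg_imp_increasing_open[of 0 s0 "\<lambda>s. h (\<gamma> s) * exp (L * s)"])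
    show "0 \<le> s0" by fact
    fix s assume s: "0 < s" "s < s0"
    have "((\<lambda>s. h (\<gamma> s) * exp (L * s)) has_real_derivative
        (fd h (\<gamma> s) v + L * h (\<gamma> s)) * exp (L * s)) (at s)"
      using s s0 by (auto intro!: derivative_eq_intros du simp: algebra_simps)
    moreover have "0 \<le> (fd h (\<gamma> s) v + L * h (\<gamma> s)) * exp (L * s)"
      using L[of s] s by (intro mult_nonneg_nonneg) auto
    ultimately show "\<exists>y. ((\<lambda>s. h (\<gamma> s) * exp (L * s)) has_real_derivative y) (at s) \<and> 0 \<le> y" by blast
  next
    show "continuous_on {0..s0} (\<lambda>s. h (\<gamma> s) * exp (L * s))"
      using s0 by (intro continuous_intros continuous_on_subset[OF cu]) auto
  qed
  then show False using s0(3) hy by (simp add: \<gamma>_def)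
qed

lemma Q_locally_constant:
  assumes "x \<in> D" "h x > 0"
  obtains r where "r > 0" "ball x r \<subseteq> D" "\<And>y. y \<in> ball x r \<Longrightarrow> h y > 0 \<and> Q y = Q x"
proof -
  have "open {y \<in> D. 0 < h y}"
  proof -
    have "open (D \<inter> h -` {0<..})"
      by (rule continuous_open_preimage[OF smooth_on_imp_continuous_on[OF smooth_h] open_domain]) simp
    moreover have "{y \<in> D. 0 < h y} = D \<inter> h -` {0<..}" by auto
    ultimately show ?thesis by simp
  qed
  then obtain r where r: "r > 0" "ball x r \<subseteq> {y \<in> D. 0 < h y}"
    using assms open_contains_ball[of "{y \<in> D. 0 < h y}"] by blast
  have "\<exists>C. \<forall>y\<in>ball x r. Q y = C"
  proof (rule has_derivative_zero_constant)
    show "(Q has_derivative (\<lambda>h. 0)) (at y within ball x r)" if "y \<in> ball x r" for y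
    proof -
      have "y \<in> D" "0 < h y" using that r(2) by blast+
      then show ?thesis unfolding Q_def[abs_def] by (rule has_derivative_at_withinI[OF conserved])
    qed
  qed simp
  then obtain C where C: "\<And>y. y \<in> ball x r \<Longrightarrow> Q y = C" by blast
  have c: "Q y = Q x" if "y \<in> ball x r" for y using C[OF that] C[of x] r(1) by simp
  show thesis by (rule that[OF r(1)]) (use r(2) c in blast)+
qed

lemma critical_point:
  assumes "x \<in> D" "(\<forall>y\<in>D. h y \<le> h x) \<or> (\<forall>y\<in>D. h x \<le> h y)"
  shows "Q x = 9 * h x powr (1/4) + \<rho> * h x powr (-3/4)"
proof -
  have "fd h x = (\<lambda>v. 0)"
    by (rule differential_zero_maxmin[OF assms(1) open_domain smooth_on_has_derivative[OF smooth_h open_domain assms(1)] assms(2)])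
  then have "g x (surface_grad f h x) v = 0" for v
    using metric_surface_grad[OF assms(1) linear_h[OF assms(1)]] by simp
  then show ?thesis by (simp add: Q_def first_integral_def grad_norm2_def)
qed

end

lemma critical_value_strict_mono:
  fixes a b :: real
  assumes "\<rho> \<le> 0" "0 < a" "a < b"
  shows "9 * a powr (1/4) + \<rho> * a powr (-3/4) < 9 * b powr (1/4) + \<rho> * b powr (-3/4)"
proof -
  have "a powr (1/4) < b powr (1/4)" using assms by (intro powr_less_mono2) auto
  moreover have "b powr (-3/4) \<le> a powr (-3/4)" using assms by (intro powr_mono2') auto
  then have "\<rho> * a powr (-3/4) \<le> \<rho> * b powr (-3/4)" using assms by (intro mult_left_mono_neg)
  ultimately show ?thesis by linarith
qed

lemma (in biconservative_patch) conserved_patchI: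
  assumes "\<And>x. x \<in> D \<Longrightarrow> h x = (H x)\<^sup>2"
  shows "conserved_patch \<rho> D f h"
proof
  show "smooth_on D h" using smooth_on_cong[OF open_domain smooth_H2] assms by simp
  show "0 \<le> h x" if "x \<in> D" for x using assms[OF that] by simp
  show "((\<lambda>y. first_integral \<rho> (h y) (grad_norm2 f h y)) has_derivative (\<lambda>_. 0)) (at x)"
    if "x \<in> D" "0 < h x" for x
  proof (rule has_derivative_transform_within_open[OF first_integral_derivative open_domain that(1)])
    show "x \<in> D" "H x \<noteq> 0" using that assms by auto
    show "first_integral \<rho> ((H y)\<^sup>2) (grad_norm2 f (\<lambda>x. (H x)\<^sup>2) y) = first_integral \<rho> (h y) (grad_norm2 f h y)"
      if "y \<in> D" for y
      using grad_norm2_cong[of h "\<lambda>x. (H x)\<^sup>2" y] assms that by simp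
  qed
qed

section \<open>Closed biconservative surfaces\<close>

text \<open>Level set and complement are both open. The values carry no topology, so the lemma
  applies to the truth value of \<open>h > 0\<close> as well as to the first integral.\<close>

lemma locally_constant_imp_constant:
  assumes "connected_space X" "p \<in> topspace X" "q \<in> topspace X"
    and loc: "\<And>p. p \<in> topspace X \<Longrightarrow> \<exists>T. openin X T \<and> p \<in> T \<and> (\<forall>q\<in>T. a q = a p)"
  shows "a p = a q"
proof -
  let ?Z = "{r \<in> topspace X. a r = a p}"
  have sub: "\<exists>T. openin X T \<and> r \<in> T \<and> T \<subseteq> {s \<in> topspace X. P (a s)}"
    if r: "r \<in> topspace X" "P (a r)" for r P
  proof -
    obtain T where T: "openin X T" "r \<in> T" "\<And>q. q \<in> T \<Longrightarrow> a q = a r" using loc[OF r(1)] by blast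
    have "T \<subseteq> {s \<in> topspace X. P (a s)}"
    proof
      fix s assume s: "s \<in> T"
      have "P (a s)" unfolding T(3)[OF s] by (rule r(2))
      then show "s \<in> {s \<in> topspace X. P (a s)}" using openin_subset[OF T(1)] s by blast
    qed
    then show ?thesis using T(1,2) by blast
  qed
  have "openin X ?Z"
    by (subst openin_subopen) (use sub[of _ "\<lambda>b. b = a p"] in blast)
  moreover have "openin X {r \<in> topspace X. a r \<noteq> a p}"
    by (subst openin_subopen) (use sub[of _ "\<lambda>b. b \<noteq> a p"] in blast)
  moreover have "topspace X - ?Z = {r \<in> topspace X. a r \<noteq> a p}" by auto
  ultimately have "openin X ?Z" "closedin X ?Z" by (auto simp: closedin_def)
  then have "?Z = topspace X"
    using assms(1,2) unfolding connected_space_clopen_in by blast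
  then have "q \<in> ?Z" using assms(3) by blast
  then show ?thesis by simp
qed

locale biconservative_surface =
  fixes \<rho> :: real and X :: "'a topology" and A :: "'a chart set" and F :: "'a \<Rightarrow> minkowski"
  assumes curvature_nonpos: "\<rho> \<le> 0" and surface: "closed_surface X A" and immersion: "immersion \<rho> X A F"
    and biconservative: "biconservative \<rho> X A F"
begin

lemma charts: assumes "(U, c) \<in> A"
  shows "openin X U" "open (c ` U)" "inj_on c U" "U \<subseteq> topspace X"
    "homeomorphic_map (subtopology X U) (top_of_set (c ` U)) c"
proof -
  have "is_chart X (U, c)" using surface assms by (auto simp: closed_surface_def smooth_surface_def)
  then show 1: "openin X U" "open (c ` U)" and h: "homeomorphic_map (subtopology X U) (top_of_set (c ` U)) c"
    by (auto simp: is_chart_def)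
  show "U \<subseteq> topspace X" using 1 openin_subset by blast
  then show "inj_on c U" using homeomorphic_imp_injective_map[OF h] by (simp add: Int_absorb1)
qed

lemma chart_inverse: "(U, c) \<in> A \<Longrightarrow> p \<in> U \<Longrightarrow> inv_into U c (c p) = p"
  using charts(3) by (simp add: inv_into_f_f)

lemma local_rep_chart: "(U, c) \<in> A \<Longrightarrow> p \<in> U \<Longrightarrow> local_rep (U, c) a (c p) = a p"
  by (simp add: local_rep_def chart_inverse)

lemma open_chart_image: assumes "(U, c) \<in> A" "openin X W" shows "open (c ` (U \<inter> W))"
proof -
  have "openin (subtopology X U) (U \<inter> W)"
    using assms(2) by (simp add: openin_subtopology_Int2 Int_commute)
  then have "openin (top_of_set (c ` U)) (c ` (U \<inter> W))"
    using homeomorphic_imp_open_map[OF charts(5)[OF assms(1)]] by (simp add: open_map_def)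
  then show ?thesis using charts(2)[OF assms(1)] openin_open_trans by blast
qed

lemma open_chart_preimage: assumes "(U, c) \<in> A" "open B" shows "openin X {q \<in> U. c q \<in> B}"
proof -
  have "openin (subtopology X U) {q \<in> topspace (subtopology X U). c q \<in> c ` U \<inter> B}"
    by (rule openin_continuous_map_preimage[OF homeomorphic_imp_continuous_map[OF charts(5)[OF assms(1)]]])
      (simp add: assms(2) openin_open_Int)
  moreover have "{q \<in> topspace (subtopology X U). c q \<in> c ` U \<inter> B} = {q \<in> U. c q \<in> B}"
    using charts(4)[OF assms(1)] by auto
  ultimately show ?thesis using charts(1)[OF assms(1)] openin_trans_full by metis
qed

lemma chart_neighborhood:
  assumes "(U, c) \<in> A" "r \<in> U" "e > 0" "\<And>s. s \<in> U \<Longrightarrow> c s \<in> ball (c r) e \<Longrightarrow> P s"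
  shows "\<exists>T. openin X T \<and> r \<in> T \<and> (\<forall>s\<in>T. P s)"
  using open_chart_preimage[OF assms(1) open_ball, of "c r" e] assms(2-4)
  by (intro exI[of _ "{s \<in> U. c s \<in> ball (c r) e}"]) auto

lemma covering: assumes "p \<in> topspace X" obtains U c where "(U, c) \<in> A" "p \<in> U"
proof -
  have "(\<Union>(U, c)\<in>A. U) = topspace X" using surface by (simp add: closed_surface_def smooth_surface_def)
  then show thesis using assms that by blast
qed

lemma immersed_chart:
  assumes "(U, c) \<in> A" "openin X W" shows "immersed_patch \<rho> (c ` (U \<inter> W)) (local_rep (U, c) F)"
proof (rule immersed_patch_subset[of _ "c ` U"])
  show "immersed_patch \<rho> (c ` U) (local_rep (U, c) F)"
  proof
    have "smooth_on (c ` (U \<inter> topspace X)) (local_rep (U, c) F)"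
      using immersion assms(1) by (auto simp: immersion_def smooth_map_on_def)
    then show "smooth_on (c ` U) (local_rep (U, c) F)" using charts(4)[OF assms(1)] by (simp add: Int_absorb2)
    show "local_rep (U, c) F x \<in> space_form \<rho>" if "x \<in> c ` U" for x
      using that subsetD[OF charts(4)[OF assms(1)]] immersion
      by (auto simp: immersion_def local_rep_chart[OF assms(1)] image_subset_iff)
    show "inj (fd (local_rep (U, c) F) x)" if "x \<in> c ` U" for x
      using that assms(1) immersion by (auto simp: immersion_def)
  qed (use curvature_nonpos charts(2)[OF assms(1)] in auto)
qed (use open_chart_image[OF assms] in auto)

lemma oriented_chart:
  assumes "(U, c) \<in> A" "unit_normal \<rho> X A F W \<eta>"
  shows "oriented_patch \<rho> (c ` (U \<inter> W)) (local_rep (U, c) F) (local_rep (U, c) \<eta>)"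
proof -
  have W: "openin X W" using assms(2) by (simp add: unit_normal_def)
  interpret immersed_patch \<rho> "c ` (U \<inter> W)" "local_rep (U, c) F" by (rule immersed_chart[OF assms(1) W])
  show ?thesis
  proof
    show "smooth_on (c ` (U \<inter> W)) (local_rep (U, c) \<eta>)"
      using assms by (auto simp: unit_normal_def smooth_map_on_def)
  qed (use assms in \<open>auto simp: unit_normal_def local_rep_chart[OF assms(1)]\<close>)
qed

text \<open>\<open>W\<close> allows shrinking to the domain of a normal. The intersections are
  nested so that each domain is a chart domain met with one open set, the form of
  \<open>immersed_chart\<close>.\<close>

lemma transition:
  assumes "(U, c) \<in> A" "(V, d) \<in> A" "openin X W"
  shows "reparametrization \<rho> (c ` (U \<inter> (V \<inter> W))) (local_rep (U, c) F) (d ` (V \<inter> (U \<inter> W))) (local_rep (V, d) F)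
    (local_rep (V, d) c)"
proof -
  have o: "openin X (V \<inter> W)" "openin X (U \<inter> W)" using charts(1) assms by auto
  interpret P: immersed_patch \<rho> "c ` (U \<inter> (V \<inter> W))" "local_rep (U, c) F"
    by (rule immersed_chart[OF assms(1) o(1)])
  interpret P': immersed_patch \<rho> "d ` (V \<inter> (U \<inter> W))" "local_rep (V, d) F"
    by (rule immersed_chart[OF assms(2) o(2)])
  show ?thesis
  proof
    have "smooth_on (d ` (V \<inter> U)) (local_rep (V, d) c)"
      using surface assms by (auto simp: closed_surface_def smooth_surface_def smooth_map_on_def)
    then show "smooth_on (d ` (V \<inter> (U \<inter> W))) (local_rep (V, d) c)"
      by (rule smooth_on_subset) auto
    show "local_rep (V, d) c y \<in> c ` (U \<inter> (V \<inter> W))" if "y \<in> d ` (V \<inter> (U \<inter> W))" for y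
      using that by (auto simp: local_rep_chart[OF assms(2)])
    show "local_rep (V, d) F y = local_rep (U, c) F (local_rep (V, d) c y)" if "y \<in> d ` (V \<inter> (U \<inter> W))" for y
      using that by (auto simp: local_rep_chart[OF assms(1)] local_rep_chart[OF assms(2)])
  qed
qed

text \<open>Makes \<open>biconservative\<close> applicable on all of \<open>U\<close>. The field
  comes from the patch of one chart, but \<open>unit_normal\<close> tests it in every chart, hence
  the transitions.\<close>

lemma unit_normal_exists: assumes "(U, c) \<in> A" shows "\<exists>\<eta>. unit_normal \<rho> X A F U \<eta>"
proof -
  have UX: "openin X U" using charts(1)[OF assms] .
  obtain \<nu> where "oriented_patch \<rho> (c ` (U \<inter> U)) (local_rep (U, c) F) \<nu>"
    using immersed_patch.normal_exists[OF immersed_chart[OF assms UX]] by blast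
  then interpret O: oriented_patch \<rho> "c ` U" "local_rep (U, c) F" \<nu> by simp
  define \<eta> where "\<eta> p = \<nu> (c p)" for p
  have "unit_normal \<rho> X A F U \<eta>"
    unfolding unit_normal_def
  proof (intro conjI)
    show "openin X U" by fact
    show "smooth_map_on A U \<eta>"
      unfolding smooth_map_on_def
    proof (clarify)
      fix V d assume V: "(V, d) \<in> A"
      interpret R: reparametrization \<rho> "c ` (U \<inter> (V \<inter> U))" "local_rep (U, c) F" "d ` (V \<inter> (U \<inter> U))"
        "local_rep (V, d) F" "local_rep (V, d) c" by (rule transition[OF assms V UX])
      have "smooth_on (d ` (V \<inter> (U \<inter> U))) (\<lambda>y. \<nu> (local_rep (V, d) c y))"
        by (rule smooth_on_compose[OF R.P'.open_domain O.open_domain _ R.smooth_\<phi> O.smooth_\<nu>])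
          (use R.\<phi>_in in auto)
      then show "smooth_on (d ` (V \<inter> U)) (local_rep (V, d) \<eta>)"
        by (simp add: local_rep_def \<eta>_def[abs_def] comp_def)
    qed
    show "\<forall>p\<in>U. \<eta> p \<in> space_form_tangent \<rho> (F p) \<and> lorentz (\<eta> p) (\<eta> p) = 1"
      proof
      fix p assume p: "p \<in> U"
      show "\<eta> p \<in> space_form_tangent \<rho> (F p) \<and> lorentz (\<eta> p) (\<eta> p) = 1"
        using O.\<nu>_tangent[of "c p"] O.\<nu>_unit[of "c p"] p by (simp add: \<eta>_def local_rep_chart[OF assms])
    qed
    show "\<forall>(V, d)\<in>A. \<forall>p\<in>V \<inter> U. \<forall>v. lorentz (\<eta> p) (fd (local_rep (V, d) F) (d p) v) = 0"
    proof (clarify)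
      fix V d p v assume V: "(V, d) \<in> A" and p: "p \<in> V" "p \<in> U"
      interpret R: reparametrization \<rho> "c ` (U \<inter> (V \<inter> U))" "local_rep (U, c) F" "d ` (V \<inter> (U \<inter> U))"
        "local_rep (V, d) F" "local_rep (V, d) c" by (rule transition[OF assms V UX])
      have "fd (local_rep (V, d) F) (d p) v = fd (local_rep (U, c) F) (c p) (fd (local_rep (V, d) c) (d p) v)"
        using R.fd_reparam[OF R.P.smooth_f R.f'_eq, of "d p" v] p local_rep_chart[OF V p(1), of c] by simp
      then show "lorentz (\<eta> p) (fd (local_rep (V, d) F) (d p) v) = 0"
        using O.\<nu>_orth[of "c p"] p by (simp add: \<eta>_def)
    qed
  qed
  then show ?thesis by blast
qed

section \<open>Gluing the squared mean curvature\<close>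

definition curv :: "'a chart \<Rightarrow> ('a \<Rightarrow> minkowski) \<Rightarrow> 'a \<Rightarrow> real" where
  "curv \<kappa> \<eta> p = mean_curvature \<rho> (local_rep \<kappa> F) (local_rep \<kappa> \<eta>) (snd \<kappa> p)"

lemma curv_chart:
  assumes "(U, c) \<in> A" "(V, d) \<in> A" "unit_normal \<rho> X A F W \<eta>" "p \<in> U" "p \<in> V" "p \<in> W"
  shows "curv (V, d) \<eta> p = curv (U, c) \<eta> p"
proof -
  have W: "openin X W" using assms(3) by (simp add: unit_normal_def)
  have o: "openin X (V \<inter> W)" "openin X (U \<inter> W)" using charts(1) assms W by auto
  interpret R: reparametrization \<rho> "c ` (U \<inter> (V \<inter> W))" "local_rep (U, c) F" "d ` (V \<inter> (U \<inter> W))"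
    "local_rep (V, d) F" "local_rep (V, d) c" by (rule transition[OF assms(1,2) W])
  have "mean_curvature \<rho> (local_rep (V, d) F) (local_rep (V, d) \<eta>) (d p)
      = mean_curvature \<rho> (local_rep (U, c) F) (local_rep (U, c) \<eta>) (local_rep (V, d) c (d p))"
  proof (rule R.mean_curvature_reparam)
    show "oriented_patch \<rho> (c ` (U \<inter> (V \<inter> W))) (local_rep (U, c) F) (local_rep (U, c) \<eta>)"
      by (rule oriented_patch_subset[OF oriented_chart[OF assms(1,3)] open_chart_image[OF assms(1) o(1)]]) auto
    show "oriented_patch \<rho> (d ` (V \<inter> (U \<inter> W))) (local_rep (V, d) F) (local_rep (V, d) \<eta>)"
      by (rule oriented_patch_subset[OF oriented_chart[OF assms(2,3)] open_chart_image[OF assms(2) o(2)]]) auto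
    show "local_rep (V, d) \<eta> y = local_rep (U, c) \<eta> (local_rep (V, d) c y)" if "y \<in> d ` (V \<inter> (U \<inter> W))" for y
      using that by (auto simp: local_rep_chart[OF assms(1)] local_rep_chart[OF assms(2)])
  qed (use assms in auto)
  then show ?thesis by (simp add: curv_def local_rep_chart[OF assms(2,5)])
qed

lemma curv_normal:
  assumes "(U, c) \<in> A" "unit_normal \<rho> X A F W \<eta>" "unit_normal \<rho> X A F W' \<eta>'" "p \<in> U" "p \<in> W" "p \<in> W'"
  shows "(curv (U, c) \<eta>' p)\<^sup>2 = (curv (U, c) \<eta> p)\<^sup>2"
proof -
  have o: "openin X (W \<inter> W')" using assms(2,3) by (auto simp: unit_normal_def)
  note oc = open_chart_image[OF assms(1) o]
  have 1: "oriented_patch \<rho> (c ` (U \<inter> (W \<inter> W'))) (local_rep (U, c) F) (local_rep (U, c) \<eta>)"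
    by (rule oriented_patch_subset[OF oriented_chart[OF assms(1,2)] oc]) auto
  have 2: "oriented_patch \<rho> (c ` (U \<inter> (W \<inter> W'))) (local_rep (U, c) F) (local_rep (U, c) \<eta>')"
    by (rule oriented_patch_subset[OF oriented_chart[OF assms(1,3)] oc]) auto
  have "c p \<in> c ` (U \<inter> (W \<inter> W'))" using assms by auto
  from oriented_patch.normal_unique[OF 1 2 this] obtain s where s: "s = 1 \<or> s = - 1"
    "curv (U, c) \<eta>' p = s * curv (U, c) \<eta> p" unfolding curv_def snd_conv by metis
  then show ?thesis by (auto simp: power_mult_distrib)
qed

text \<open>The squared mean curvature on the whole surface. The choice is harmless: changing the
  chart preserves the mean curvature and changing the normal affects only its sign.\<close>

definition h :: "'a \<Rightarrow> real" where
  "h p = (SOME k. \<exists>W \<eta> U c. unit_normal \<rho> X A F W \<eta> \<and> (U, c) \<in> A \<and> p \<in> U \<inter> W \<and> k = (curv (U, c) \<eta> p)\<^sup>2)"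

lemma h_eq:
  assumes "unit_normal \<rho> X A F W \<eta>" "(U, c) \<in> A" "p \<in> U" "p \<in> W"
  shows "h p = (curv (U, c) \<eta> p)\<^sup>2"
proof -
  have "\<exists>W \<eta> U c. unit_normal \<rho> X A F W \<eta> \<and> (U, c) \<in> A \<and> p \<in> U \<inter> W \<and> h p = (curv (U, c) \<eta> p)\<^sup>2"
    unfolding h_def by (rule someI_ex) (use assms in blast)
  then obtain W' \<eta>' V d where *: "unit_normal \<rho> X A F W' \<eta>'" "(V, d) \<in> A" "p \<in> V" "p \<in> W'"
    "h p = (curv (V, d) \<eta>' p)\<^sup>2" by blast
  have "curv (V, d) \<eta>' p = curv (U, c) \<eta>' p" by (rule curv_chart[OF assms(2) *(2,1) assms(3) *(3,4)])
  then show ?thesis using curv_normal[OF assms(2,1) *(1) assms(3,4) *(4)] * by simp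
qed

lemma conserved_chart:
  assumes "(U, c) \<in> A" shows "conserved_patch \<rho> (c ` U) (local_rep (U, c) F) (local_rep (U, c) h)"
proof -
  obtain \<eta> where \<eta>: "unit_normal \<rho> X A F U \<eta>" using unit_normal_exists[OF assms] by blast
  interpret O: oriented_patch \<rho> "c ` U" "local_rep (U, c) F" "local_rep (U, c) \<eta>"
    using oriented_chart[OF assms \<eta>] by simp
  interpret B: biconservative_patch \<rho> "c ` U" "local_rep (U, c) F" "local_rep (U, c) \<eta>"
  proof
    fix x assume "x \<in> c ` U"
    then show "biconservative_at \<rho> (local_rep (U, c) F) (local_rep (U, c) \<eta>) x"
      using biconservative[unfolded biconservative_def, rule_format, OF \<eta> assms] by auto
  qed
  show ?thesis
  proof (rule B.conserved_patchI)
    fix x assume "x \<in> c ` U"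
    then obtain p where p: "p \<in> U" "x = c p" by blast
    then show "local_rep (U, c) h x = (mean_curvature \<rho> (local_rep (U, c) F) (local_rep (U, c) \<eta>) x)\<^sup>2"
      using h_eq[OF \<eta> assms p(1,1)] by (simp add: curv_def local_rep_chart[OF assms p(1)])
  qed
qed

section \<open>The first integral on the whole surface\<close>

definition chart_integral :: "'a chart \<Rightarrow> 'a \<Rightarrow> real" where
  "chart_integral \<kappa> p = conserved_patch.Q \<rho> (local_rep \<kappa> F) (local_rep \<kappa> h) (snd \<kappa> p)"

lemma chart_integral_chart:
  assumes "(U, c) \<in> A" "(V, d) \<in> A" "p \<in> U" "p \<in> V"
  shows "chart_integral (V, d) p = chart_integral (U, c) p"
proof -
  interpret R: reparametrization \<rho> "c ` (U \<inter> (V \<inter> topspace X))" "local_rep (U, c) F"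
    "d ` (V \<inter> (U \<inter> topspace X))" "local_rep (V, d) F" "local_rep (V, d) c"
    by (rule transition[OF assms(1,2) openin_topspace])
  interpret C: conserved_patch \<rho> "c ` U" "local_rep (U, c) F" "local_rep (U, c) h"
    by (rule conserved_chart[OF assms(1)])
  interpret C': conserved_patch \<rho> "d ` V" "local_rep (V, d) F" "local_rep (V, d) h"
    by (rule conserved_chart[OF assms(2)])
  have "grad_norm2 (local_rep (V, d) F) (local_rep (V, d) h) (d p)
      = grad_norm2 (local_rep (U, c) F) (local_rep (U, c) h) (local_rep (V, d) c (d p))"
  proof (rule R.grad_norm2_reparam)
    show "smooth_on (c ` (U \<inter> (V \<inter> topspace X))) (local_rep (U, c) h)"
      by (rule smooth_on_subset[OF C.smooth_h]) auto
    show "smooth_on (d ` (V \<inter> (U \<inter> topspace X))) (local_rep (V, d) h)"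
      by (rule smooth_on_subset[OF C'.smooth_h]) auto
    show "local_rep (V, d) h y = local_rep (U, c) h (local_rep (V, d) c y)"
      if "y \<in> d ` (V \<inter> (U \<inter> topspace X))" for y
      using that by (auto simp: local_rep_chart[OF assms(1)] local_rep_chart[OF assms(2)])
    show "d p \<in> d ` (V \<inter> (U \<inter> topspace X))" using assms charts(4) by blast
  qed
  then show ?thesis
    by (simp add: chart_integral_def C.Q_def C'.Q_def local_rep_chart[OF assms(2,4)] local_rep_chart[OF assms(1,3)])
qed

definition first_integral_at :: "'a \<Rightarrow> real" where
  "first_integral_at p = chart_integral (SOME \<kappa>. \<kappa> \<in> A \<and> p \<in> fst \<kappa>) p"

lemma first_integral_at_eq: assumes "(U, c) \<in> A" "p \<in> U" shows "first_integral_at p = chart_integral (U, c) p"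
proof -
  let ?\<kappa> = "SOME \<kappa>. \<kappa> \<in> A \<and> p \<in> fst \<kappa>"
  have "?\<kappa> \<in> A \<and> p \<in> fst ?\<kappa>" by (rule someI[of _ "(U, c)"]) (use assms in auto)
  then show ?thesis using chart_integral_chart[OF assms(1) _ assms(2), of "fst ?\<kappa>" "snd ?\<kappa>"]
    by (simp add: first_integral_at_def)
qed

lemma h_nonneg: assumes "p \<in> topspace X" shows "h p \<ge> 0"
proof -
  obtain U c where U: "(U, c) \<in> A" "p \<in> U" using covering[OF assms] .
  then obtain \<eta> where "unit_normal \<rho> X A F U \<eta>" using unit_normal_exists by blast
  from h_eq[OF this U U(2)] show ?thesis by simp
qed

text \<open>Continuity is local, so it can be checked in charts and pasted over their
  domains.\<close>

lemma continuous_mapI: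
  assumes "openin X W"
    and "\<And>U c. (U, c) \<in> A \<Longrightarrow> continuous_on (c ` (U \<inter> W)) (local_rep (U, c) a)"
  shows "continuous_map (subtopology X W) euclideanreal a"
proof (rule pasting_lemma[where I = A and T = "\<lambda>\<kappa>. W \<inter> fst \<kappa>" and f = "\<lambda>_. a"])
  fix \<kappa> assume k: "\<kappa> \<in> A"
  obtain U c where \<kappa>: "\<kappa> = (U, c)" by fastforce
  note U = k[unfolded \<kappa>]
  show "openin (subtopology X W) (W \<inter> fst \<kappa>)"
    using charts(1)[OF U] by (simp add: \<kappa> openin_subtopology_Int2)
  have sub: "subtopology (subtopology X W) (W \<inter> fst \<kappa>) = subtopology (subtopology X U) (U \<inter> W)"
    by (simp add: \<kappa> subtopology_subtopology Int_ac)
  have "continuous_map (subtopology X U) (top_of_set (c ` U)) c"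
    by (rule homeomorphic_imp_continuous_map[OF charts(5)[OF U]])
  then have "continuous_map (subtopology X U) euclidean c"
    using continuous_map_into_fulltopology by blast
  then have "continuous_map (subtopology (subtopology X U) (U \<inter> W)) (top_of_set (c ` (U \<inter> W))) c"
    by (intro continuous_map_into_subtopology continuous_map_from_subtopology[of "subtopology X U"]) auto
  moreover have "continuous_map (top_of_set (c ` (U \<inter> W))) euclideanreal (local_rep (U, c) a)"
    using assms(2)[OF U] by simp
  ultimately have "continuous_map (subtopology (subtopology X U) (U \<inter> W)) euclideanreal (local_rep (U, c) a \<circ> c)"
    by (rule continuous_map_compose)
  then show "continuous_map (subtopology (subtopology X W) (W \<inter> fst \<kappa>)) euclideanreal a"
    unfolding sub by (rule continuous_map_eq) (auto simp: local_rep_chart[OF U])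
next
  fix p assume p: "p \<in> topspace (subtopology X W)"
  then have "p \<in> topspace X" "p \<in> W" by auto
  then obtain U c where "(U, c) \<in> A" "p \<in> U" using covering by metis
  then show "\<exists>j. j \<in> A \<and> p \<in> W \<inter> fst j \<and> a p = a p" using \<open>p \<in> W\<close> by force
qed simp

text \<open>Compactness supplies the extrema. Connectedness enters twice: for the truth value of
  \<open>h > 0\<close>, and, once \<open>h\<close> is positive everywhere, for the first
  integral.\<close>

lemma h_constant:
  assumes "p \<in> topspace X" "q \<in> topspace X" shows "h p = h q"
proof -
  have con: "connected_space X" and com: "compact_space X" using surface by (auto simp: closed_surface_def)
  have "continuous_map (subtopology X (topspace X)) euclideanreal h"
  proof (rule continuous_mapI)
    fix U c assume U: "(U, c) \<in> A"
    interpret conserved_patch \<rho> "c ` U" "local_rep (U, c) F" "local_rep (U, c) h" by (rule conserved_chart[OF U])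
    show "continuous_on (c ` (U \<inter> topspace X)) (local_rep (U, c) h)"
      by (rule continuous_on_subset[OF smooth_on_imp_continuous_on[OF smooth_h]]) auto
  qed simp
  then have "compact (h ` topspace X)"
    using image_compactin[of X "topspace X" euclideanreal h] com by (simp add: compact_space_def)
  moreover have "h ` topspace X \<noteq> {}" using assms by auto
  ultimately obtain a b where "a \<in> h ` topspace X" "\<And>k. k \<in> h ` topspace X \<Longrightarrow> k \<le> a"
    "b \<in> h ` topspace X" "\<And>k. k \<in> h ` topspace X \<Longrightarrow> b \<le> k"
    using compact_attains_sup[of "h ` topspace X"] compact_attains_inf[of "h ` topspace X"] by blast
  then obtain p0 p1 where p0: "p0 \<in> topspace X" "\<And>q. q \<in> topspace X \<Longrightarrow> h q \<le> h p0"
    and p1: "p1 \<in> topspace X" "\<And>q. q \<in> topspace X \<Longrightarrow> h p1 \<le> h q" by blast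
  have pos_const: "(h r > 0) = (h p0 > 0)" if "r \<in> topspace X" for r
  proof (rule locally_constant_imp_constant[OF con that p0(1), of "\<lambda>r. h r > 0"])
    fix r assume "r \<in> topspace X"
    then obtain U c where U: "(U, c) \<in> A" "r \<in> U" using covering by metis
    interpret conserved_patch \<rho> "c ` U" "local_rep (U, c) F" "local_rep (U, c) h" by (rule conserved_chart[OF U(1)])
    note lr = local_rep_chart[OF U(1)]
    have "c r \<in> c ` U" using U by blast
    then obtain e where e: "e > 0" "ball (c r) e \<subseteq> c ` U" using open_domain open_contains_ball by blast
    have "h s > 0 \<longleftrightarrow> h r > 0" if s: "s \<in> U" "c s \<in> ball (c r) e" for s
    proof -
      \<comment> \<open>Running through the segment in both directions carries positivity from
        \<open>s\<close> to \<open>r\<close> and back; the bound required on the way is the global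
        maximum \<open>h p0\<close>.\<close>
      have seg: "closed_segment (c s) (c r) \<subseteq> c ` U" "closed_segment (c r) (c s) \<subseteq> c ` U"
        using closed_segment_subset[OF s(2) _ convex_ball, of "c r"]
          closed_segment_subset[OF _ s(2) convex_ball, of "c r"] e by auto
      have M: "local_rep (U, c) h z \<le> h p0" if "z \<in> c ` U" for z
        using that p0(2) subsetD[OF charts(4)[OF U(1)]] by (auto simp: lr)
      show ?thesis
        using positive_along_segment[OF seg(1) _ M] positive_along_segment[OF seg(2) _ M]
          lr[OF s(1), of h] lr[OF U(2), of h] by auto
    qed
    then show "\<exists>T. openin X T \<and> r \<in> T \<and> (\<forall>s\<in>T. (0 < h s) = (0 < h r))"
      by (rule chart_neighborhood[OF U e(1)])
  qed
  have "h p0 = h p1"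
  proof (cases "h p0 > 0")
    case False
    then show ?thesis using h_nonneg[OF p1(1)] p0(2)[OF p1(1)] by simp
  next
    case True
    then have pos: "h r > 0" if "r \<in> topspace X" for r using pos_const[OF that] by simp
    have Qc: "first_integral_at p0 = first_integral_at p1"
    proof (rule locally_constant_imp_constant[OF con p0(1) p1(1)])
      fix r assume r: "r \<in> topspace X"
      then obtain U c where U: "(U, c) \<in> A" "r \<in> U" using covering by metis
      interpret C: conserved_patch \<rho> "c ` U" "local_rep (U, c) F" "local_rep (U, c) h" by (rule conserved_chart[OF U(1)])
      have "c r \<in> c ` U" using U by blast
      then obtain e where e: "e > 0" "ball (c r) e \<subseteq> c ` U" "\<And>y. y \<in> ball (c r) e \<Longrightarrow> C.Q y = C.Q (c r)"
        using C.Q_locally_constant[of "c r"] pos[OF r] local_rep_chart[OF U, of h] by metis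
      have "first_integral_at s = first_integral_at r" if "s \<in> U" "c s \<in> ball (c r) e" for s
        using e(3)[OF that(2)] first_integral_at_eq[OF U(1) that(1)] first_integral_at_eq[OF U] by (simp add: chart_integral_def)
      then show "\<exists>T. openin X T \<and> r \<in> T \<and> (\<forall>s\<in>T. first_integral_at s = first_integral_at r)"
        by (rule chart_neighborhood[OF U e(1)])
    qed
    have crit: "first_integral_at r = 9 * h r powr (1/4) + \<rho> * h r powr (-3/4)"
      if r: "r \<in> topspace X" and ext: "(\<forall>q\<in>topspace X. h q \<le> h r) \<or> (\<forall>q\<in>topspace X. h r \<le> h q)" for r
    proof -
      obtain U c where U: "(U, c) \<in> A" "r \<in> U" using covering[OF r] .
      interpret C: conserved_patch \<rho> "c ` U" "local_rep (U, c) F" "local_rep (U, c) h" by (rule conserved_chart[OF U(1)])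
      have "C.Q (c r) = 9 * local_rep (U, c) h (c r) powr (1/4) + \<rho> * local_rep (U, c) h (c r) powr (-3/4)"
      proof (rule C.critical_point)
        show "c r \<in> c ` U" using U by blast
        show "(\<forall>y\<in>c ` U. local_rep (U, c) h y \<le> local_rep (U, c) h (c r)) \<or>
            (\<forall>y\<in>c ` U. local_rep (U, c) h (c r) \<le> local_rep (U, c) h y)"
          using ext charts(4)[OF U(1)] U(2) by (auto simp: subset_iff local_rep_chart[OF U(1)])
      qed
      then show ?thesis using first_integral_at_eq[OF U] local_rep_chart[OF U, of h] by (simp add: chart_integral_def)
    qed
    have "\<not> h p1 < h p0"
      using critical_value_strict_mono[OF curvature_nonpos pos[OF p1(1)], of "h p0"] Qc crit[OF p0(1)] crit[OF p1(1)] p0(2) p1(2)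
      by force
    then show ?thesis using p0(2)[OF p1(1)] by simp
  qed
  then show ?thesis using p0(2) p1(2) assms by (metis order_antisym)
qed

text \<open>Constancy of \<open>h\<close> fixes \<open>H\<close> only up to sign. On a connected
  \<open>W\<close> the continuous \<open>H\<close> has a finite connected image, hence one
  value.\<close>

lemma cmc: "cmc \<rho> X A F"
  unfolding cmc_def
proof (intro allI impI, elim conjE)
  fix W \<eta> assume \<eta>: "unit_normal \<rho> X A F W \<eta>" and con: "connectedin X W"
  have W: "openin X W" using \<eta> by (simp add: unit_normal_def)
  then have WX: "W \<subseteq> topspace X" by (rule openin_subset)
  define a where "a p = curv (SOME \<kappa>. \<kappa> \<in> A \<and> p \<in> fst \<kappa>) \<eta> p" for p
  have a_eq: "a p = curv (U, c) \<eta> p" if U: "(U, c) \<in> A" "p \<in> U" "p \<in> W" for U c p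
  proof -
    let ?\<kappa> = "SOME \<kappa>. \<kappa> \<in> A \<and> p \<in> fst \<kappa>"
    have "?\<kappa> \<in> A \<and> p \<in> fst ?\<kappa>" by (rule someI[of _ "(U, c)"]) (use U in auto)
    then show ?thesis
      using curv_chart[OF U(1) _ \<eta> U(2) _ U(3), of "fst ?\<kappa>" "snd ?\<kappa>"] by (simp add: a_def)
  qed
  have "continuous_map (subtopology X W) euclideanreal a"
  proof (rule continuous_mapI[OF W])
    fix U c assume U: "(U, c) \<in> A"
    interpret oriented_patch \<rho> "c ` (U \<inter> W)" "local_rep (U, c) F" "local_rep (U, c) \<eta>"
      by (rule oriented_chart[OF U \<eta>])
    show "continuous_on (c ` (U \<inter> W)) (local_rep (U, c) a)"
      by (rule continuous_on_eq[OF smooth_on_imp_continuous_on[OF smooth_H]])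
        (use a_eq[OF U] in \<open>auto simp: curv_def local_rep_chart[OF U]\<close>)
  qed
  then have "connectedin euclideanreal (a ` W)"
    by (rule connectedin_continuous_map_image) (use con in \<open>simp add: connectedin_subtopology\<close>)
  then have conn: "connected (a ` W)" by simp
  have sq: "(a p)\<^sup>2 = h p" if "p \<in> W" for p
  proof -
    have "p \<in> topspace X" using WX that by blast
    then obtain U c where U: "(U, c) \<in> A" "p \<in> U" by (rule covering)
    show ?thesis using a_eq[OF U that] h_eq[OF \<eta> U that] by simp
  qed
  show "\<exists>H. \<forall>(U, c)\<in>A. \<forall>p\<in>U \<inter> W. mean_curvature \<rho> (local_rep (U, c) F) (local_rep (U, c) \<eta>) (c p) = H"
  proof (cases "W = {}")
    case False
    then obtain p where p: "p \<in> W" by blast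
    have "a ` W \<subseteq> {a p, - a p}"
    proof (rule image_subsetI)
      fix q assume q: "q \<in> W"
      have "h q = h p" using h_constant WX p q by blast
      then have "(a q)\<^sup>2 = (a p)\<^sup>2" using sq[OF p] sq[OF q] by simp
      then show "a q \<in> {a p, - a p}" by (simp add: power2_eq_iff)
    qed
    then have "finite (a ` W)" by (rule finite_subset) simp
    then obtain k where "a ` W = {k}" using conn p connected_finite_iff_sing by blast
    then have "a q = k" if "q \<in> W" for q using that by blast
    then have "curv (U, c) \<eta> q = k" if "(U, c) \<in> A" "q \<in> U \<inter> W" for U c q
      using a_eq[of U c q] that by simp
    then show ?thesis by (intro exI[of _ k]) (auto simp: curv_def)
  qed simp
qed

end

theorem proposition5p2:
  fixes \<rho> :: real
  assumes "\<rho> \<le> 0"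
  shows "\<not> (\<exists>(X :: 'a topology) A F.
           closed_surface X A \<and> immersion \<rho> X A F \<and>
           biconservative \<rho> X A F \<and> \<not> cmc \<rho> X A F)"
  using biconservative_surface.cmc[OF biconservative_surface.intro[OF assms]] by blast

end
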